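(* The arithmetic compactification $E_0(\mathbb N)$ is totally disconnected but not extremely disconnected (i.e., there is an open subset of $E_0(\mathbb N)$ whose closure is not open).
   Context: $\mathbb N=\{0,1,2,\ldots\}$ and $l^\infty(\mathbb N)$ is the C*-algebra of bounded complex-valued functions on $\mathbb N$. Let $(\sigma_Af)(n)=f(n+1)$. An anqie is a unital C*-subalgebra $\mathcal A\subseteq l^\infty(\mathbb N)$ with $\sigma_A(\mathcal A)\subseteq\mathcal A$; $\mathcal A_{\{f\}}$ is the smallest anqie containing $f$. For an anqie $\mathcal A$ with maximal ideal space $X$, $A:X\to X$, $(A\rho)(g)=\rho(\sigma_Ag)$, is continuous and the anqie entropy is $\mathrm{AE}(\mathcal A)=h(A)$ (topological entropy); $\mathrm{AE}(f)=\mathrm{AE}(\mathcal A_{\{f\}})$. Let $\mathcal E_0(\mathbb N)=\{f\in l^\infty(\mathbb N):\mathrm{AE}(f)=0\}$ (this is an anqie), and let $E_0(\mathbb N)$, the arithmetic compactification of $\mathbb N$, be the maximal ideal space of $\mathcal E_0(\mathbb N)$ with the weak* topology. Totally disconnected means any two distinct points are separated by a clopen set. *)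

theory Defs
  imports "HOL-Analysis.Analysis"
begin

type_synonym seq = "nat \<Rightarrow> complex"

definition linfty :: "seq set" where
  "linfty = {f. bounded (range f)}"

definition shift :: "seq \<Rightarrow> seq" where
  "shift f = (\<lambda>n. f (Suc n))"

definition anqie :: "seq set \<Rightarrow> bool" where
  "anqie A \<longleftrightarrow>
     A \<subseteq> linfty \<and>
     (\<lambda>n. 1) \<in> A \<and>
     (\<forall>f\<in>A. \<forall>g\<in>A. (\<lambda>n. f n + g n) \<in> A) \<and>
     (\<forall>f\<in>A. \<forall>g\<in>A. (\<lambda>n. f n * g n) \<in> A) \<and>
     (\<forall>c. \<forall>f\<in>A. (\<lambda>n. c * f n) \<in> A) \<and>
     (\<forall>f\<in>A. (\<lambda>n. cnj (f n)) \<in> A) \<and>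
     (\<forall>g\<in>linfty. (\<forall>e>0. \<exists>f\<in>A. \<forall>n. norm (f n - g n) \<le> e) \<longrightarrow> g \<in> A) \<and>
     (\<forall>f\<in>A. shift f \<in> A)"

definition anqie_gen :: "seq \<Rightarrow> seq set" where
  "anqie_gen f = \<Inter>{A. anqie A \<and> f \<in> A}"

text \<open>Characters (nonzero multiplicative linear functionals) of A, i.e. points of
  the maximal ideal space; represented as functions on all sequences that vanish
  outside A.\<close>
definition character :: "seq set \<Rightarrow> (seq \<Rightarrow> complex) \<Rightarrow> bool" where
  "character A \<rho> \<longleftrightarrow>
     (\<forall>f\<in>A. \<forall>g\<in>A. \<rho> (\<lambda>n. f n + g n) = \<rho> f + \<rho> g) \<and>
     (\<forall>c. \<forall>f\<in>A. \<rho> (\<lambda>n. c * f n) = c * \<rho> f) \<and>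
     (\<forall>f\<in>A. \<forall>g\<in>A. \<rho> (\<lambda>n. f n * g n) = \<rho> f * \<rho> g) \<and>
     \<rho> (\<lambda>n. 1) = 1 \<and>
     (\<forall>g. g \<notin> A \<longrightarrow> \<rho> g = 0)"

text \<open>Maximal ideal space with the weak* topology (topology of pointwise
  convergence on A; the product topology restricted to the characters).\<close>
definition max_ideal_space :: "seq set \<Rightarrow> (seq \<Rightarrow> complex) topology" where
  "max_ideal_space A = subtopology euclidean {\<rho>. character A \<rho>}"

definition induced_map :: "seq set \<Rightarrow> (seq \<Rightarrow> complex) \<Rightarrow> (seq \<Rightarrow> complex)" where
  "induced_map A \<rho> = (\<lambda>g. if g \<in> A then \<rho> (shift g) else 0)"

definition open_cover :: "'a topology \<Rightarrow> 'a set set \<Rightarrow> bool" where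
  "open_cover X \<U> \<longleftrightarrow> (\<forall>U\<in>\<U>. openin X U) \<and> \<Union>\<U> = topspace X"

definition min_subcover_card :: "'a topology \<Rightarrow> 'a set set \<Rightarrow> nat" where
  "min_subcover_card X \<U> = (LEAST k. \<exists>\<W>. \<W> \<subseteq> \<U> \<and> finite \<W> \<and> \<Union>\<W> = topspace X \<and> card \<W> = k)"

definition iter_join :: "'a topology \<Rightarrow> ('a \<Rightarrow> 'a) \<Rightarrow> 'a set set \<Rightarrow> nat \<Rightarrow> 'a set set" where
  "iter_join X T \<U> n =
     {{x \<in> topspace X. \<forall>i<n. (T ^^ i) x \<in> U i} | U. \<forall>i<n. U i \<in> \<U>}"

definition cover_entropy :: "'a topology \<Rightarrow> ('a \<Rightarrow> 'a) \<Rightarrow> 'a set set \<Rightarrow> real" where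
  "cover_entropy X T \<U> = lim (\<lambda>n. ln (real (min_subcover_card X (iter_join X T \<U> n))) / real n)"

definition top_entropy :: "'a topology \<Rightarrow> ('a \<Rightarrow> 'a) \<Rightarrow> ereal" where
  "top_entropy X T = (SUP \<U> \<in> {\<U>. open_cover X \<U>}. ereal (cover_entropy X T \<U>))"

definition anqie_entropy :: "seq set \<Rightarrow> ereal" where
  "anqie_entropy A = top_entropy (max_ideal_space A) (induced_map A)"

definition AE_seq :: "seq \<Rightarrow> ereal" where
  "AE_seq f = anqie_entropy (anqie_gen f)"

definition E0_alg :: "seq set" where
  "E0_alg = {f \<in> linfty. AE_seq f = 0}"

definition arith_compactification :: "(seq \<Rightarrow> complex) topology" where
  "arith_compactification = max_ideal_space E0_alg"

definition totally_disconnected_space :: "'a topology \<Rightarrow> bool" where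
  "totally_disconnected_space X \<longleftrightarrow>
     (\<forall>x\<in>topspace X. \<forall>y\<in>topspace X. x \<noteq> y \<longrightarrow>
        (\<exists>C. closedin X C \<and> openin X C \<and> x \<in> C \<and> y \<notin> C))"

definition extremely_disconnected_space :: "'a topology \<Rightarrow> bool" where
  "extremely_disconnected_space X \<longleftrightarrow>
     (\<forall>U. openin X U \<longrightarrow> openin X (X closure_of U))"

end

theory Submission
  imports Defs
begin

text \<open>
  Entropy zero of an anqie \<open>A\<close> amounts to a counting condition on each \<open>f \<in> A\<close>: up to any
  error, the windows of length \<open>n\<close> of \<open>f\<close> fall into subexponentially many classes. The point
  evaluations being dense in the maximal ideal space, a Lebesgue-number argument turns such
  classes into subcovers and conversely; the condition is visibly stable under the anqie operations.

  Total disconnectedness: every such \<open>f\<close> is a uniform limit of finite-valued functions of entropy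
  zero, whose level sets give clopen sets. Rounding alone may create entropy, so each aligned block
  of length \<open>L\<^sub>k\<close> is replaced by the first one with nearly the same values of \<open>f\<close>, for all \<open>k\<close> of a
  sequence \<open>L\<^sub>0 | L\<^sub>1 | \<dots>\<close>, and only then are the values rounded.

  Failure of extreme disconnectedness: the point evaluations are isolated, so any \<open>S \<subseteq> \<nat>\<close> spans an
  open set whose closure meets \<open>\<nat>\<close> in \<open>S\<close>. Were the closure open, the indicator of \<open>S\<close> would have
  entropy zero, which fails when every 0-1 word occurs in it.
\<close>

section \<open>Sequences of slow growth\<close>

text \<open>The code labels starting positions: each of the \<open>N\<close> available labels stands
  for a class of length-\<open>n\<close> windows of diameter at most \<open>e\<close>, and one label
  serves all members of \<open>F\<close> at once. Taking \<open>N\<close> as a mere upper bound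
  avoids minimal counts.\<close>

definition block_code :: "seq set \<Rightarrow> real \<Rightarrow> nat \<Rightarrow> nat \<Rightarrow> bool" where
  "block_code F e n N \<longleftrightarrow> (\<exists>c::nat \<Rightarrow> nat. (\<forall>m. c m < N) \<and>
     (\<forall>m m' i f. c m = c m' \<longrightarrow> i < n \<longrightarrow> f \<in> F \<longrightarrow> dist (f (m + i)) (f (m' + i)) \<le> e))"

definition slow :: "seq set \<Rightarrow> bool" where
  "slow F \<longleftrightarrow> (\<forall>e>0. \<forall>d>0. \<forall>\<^sub>F n in sequentially.
     \<exists>N. block_code F e n N \<and> real N \<le> exp (d * real n))"

lemma slowD:
  "\<lbrakk>slow F; e > 0; d > 0\<rbrakk> \<Longrightarrow> \<forall>\<^sub>F n in sequentially. \<exists>N. block_code F e n N \<and> real N \<le> exp (d * real n)"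
  unfolding slow_def by blast

text \<open>Natural labels are pairs, lists or members of a subcover; numbering a finite label set
  brings them to numerical form.\<close>

lemma block_codeI:
  fixes c :: "nat \<Rightarrow> 'b"
  assumes "finite S" "\<And>m. c m \<in> S" "card S \<le> N"
    and c: "\<And>m m' i f. \<lbrakk>c m = c m'; i < n; f \<in> F\<rbrakk> \<Longrightarrow> dist (f (m + i)) (f (m' + i)) \<le> e"
  shows "block_code F e n N"
proof -
  obtain h where h: "bij_betw h S {0..<card S}"
    using ex_bij_betw_finite_nat[OF \<open>finite S\<close>] by blast
  have "h (c m) < N" for m
    using bij_betwE[OF h] assms(2)[of m] assms(3) by fastforce
  moreover have "c m = c m'" if "h (c m) = h (c m')" for m m'
    using that bij_betw_imp_inj_on[OF h] assms(2) by (meson inj_onD)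
  ultimately show ?thesis
    unfolding block_code_def by (intro exI[of _ "\<lambda>m. h (c m)"]) (use c in blast)
qed

lemma slow_empty: "slow {}"
proof -
  have "block_code {} e n 1" for e n
    unfolding block_code_def by auto
  then have "\<exists>N. block_code {} e n N \<and> real N \<le> exp (d * real n)" if "d > 0" for e d n
    using that by (intro exI[of _ 1]) auto
  then show ?thesis
    unfolding slow_def by (auto intro!: always_eventually)
qed

text \<open>Pairing two codes multiplies their counts, so each family is given half of the
  exponent.\<close>

lemma slow_Un:
  assumes "slow F" "slow G"
  shows "slow (F \<union> G)"
  unfolding slow_def
proof (intro allI impI)
  fix e d :: real assume "e > 0" "d > 0"
  then have "\<forall>\<^sub>F n in sequentially. \<exists>N. block_code F e n N \<and> real N \<le> exp (d/2 * real n)"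
            "\<forall>\<^sub>F n in sequentially. \<exists>N. block_code G e n N \<and> real N \<le> exp (d/2 * real n)"
    using slowD[OF assms(1) \<open>e > 0\<close> half_gt_zero[OF \<open>d > 0\<close>]]
      slowD[OF assms(2) \<open>e > 0\<close> half_gt_zero[OF \<open>d > 0\<close>]] by auto
  then show "\<forall>\<^sub>F n in sequentially. \<exists>N. block_code (F \<union> G) e n N \<and> real N \<le> exp (d * real n)"
  proof eventually_elim
    case (elim n)
    then obtain N M where N: "block_code F e n N" "real N \<le> exp (d/2 * real n)"
      and M: "block_code G e n M" "real M \<le> exp (d/2 * real n)" by auto
    obtain c where c: "\<And>m. c m < N"
      "\<And>m m' i f. \<lbrakk>c m = c m'; i < n; f \<in> F\<rbrakk> \<Longrightarrow> dist (f (m + i)) (f (m' + i)) \<le> e"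
      using N(1) unfolding block_code_def by blast
    obtain c' where c': "\<And>m. c' m < M"
      "\<And>m m' i f. \<lbrakk>c' m = c' m'; i < n; f \<in> G\<rbrakk> \<Longrightarrow> dist (f (m + i)) (f (m' + i)) \<le> e"
      using M(1) unfolding block_code_def by blast
    have "block_code (F \<union> G) e n (N * M)"
      by (rule block_codeI[of "{..<N} \<times> {..<M}" "\<lambda>m. (c m, c' m)"]) (use c c' in auto)
    moreover have "real (N * M) \<le> exp (d/2 * real n) * exp (d/2 * real n)"
      using N(2) M(2) by (simp add: mult_mono)
    moreover have "exp (d/2 * real n) * exp (d/2 * real n) = exp (d * real n)"
      by (simp flip: exp_add add: field_simps)
    ultimately show ?case by auto
  qed
qed

lemma slow_finite:
  assumes "finite F" "\<And>f. f \<in> F \<Longrightarrow> slow {f}"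
  shows "slow F"
  using assms
proof (induction F rule: finite_induct)
  case empty show ?case by (rule slow_empty)
next
  case (insert x F)
  then show ?case using slow_Un[of "{x}" F] by auto
qed

text \<open>A code for \<open>F\<close> at tolerance \<open>d\<close> is a code for \<open>g\<close>
  with the same labels. This handles all pointwise operations, uniform limits and, later, indicators
  of clopen sets.\<close>

lemma slow_transfer:
  assumes "\<And>e. e > 0 \<Longrightarrow> \<exists>F d. d > 0 \<and> slow F \<and>
     (\<forall>m m'. (\<forall>f\<in>F. dist (f m) (f m') \<le> d) \<longrightarrow> dist (g m) (g m') \<le> e)"
  shows "slow {g}"
  unfolding slow_def
proof (intro allI impI)
  fix e d :: real assume e: "e > 0" and d: "d > 0"
  obtain F e' where F: "e' > 0" "slow F"
    "\<And>m m'. (\<forall>f\<in>F. dist (f m) (f m') \<le> e') \<Longrightarrow> dist (g m) (g m') \<le> e"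
    using assms[OF e] by blast
  have "block_code {g} e n N" if "block_code F e' n N" for n N
    using that F(3) unfolding block_code_def by (metis singletonD)
  moreover have "\<forall>\<^sub>F n in sequentially. \<exists>N. block_code F e' n N \<and> real N \<le> exp (d * real n)"
    using F d unfolding slow_def by blast
  ultimately show "\<forall>\<^sub>F n in sequentially. \<exists>N. block_code {g} e n N \<and> real N \<le> exp (d * real n)"
    by (force elim: eventually_mono)
qed

section \<open>The anqie of slow bounded sequences\<close>

lemma linftyI: "(\<And>n. norm (f n) \<le> B) \<Longrightarrow> f \<in> linfty"
  unfolding linfty_def bounded_iff by auto

lemma linfty_bound: "f \<in> linfty \<Longrightarrow> \<exists>B>0. \<forall>n. norm (f n) \<le> B"
  unfolding linfty_def by (auto simp: bounded_pos)

lemma anqieI: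
  assumes "A \<subseteq> linfty" "(\<lambda>n. 1) \<in> A"
    and "\<And>f g. f \<in> A \<Longrightarrow> g \<in> A \<Longrightarrow> (\<lambda>n. f n + g n) \<in> A"
    and "\<And>f g. f \<in> A \<Longrightarrow> g \<in> A \<Longrightarrow> (\<lambda>n. f n * g n) \<in> A"
    and "\<And>f c. f \<in> A \<Longrightarrow> (\<lambda>n. c * f n) \<in> A"
    and "\<And>f. f \<in> A \<Longrightarrow> (\<lambda>n. cnj (f n)) \<in> A"
    and "\<And>g. g \<in> linfty \<Longrightarrow> \<forall>e>0. \<exists>f\<in>A. \<forall>n. norm (f n - g n) \<le> e \<Longrightarrow> g \<in> A"
    and "\<And>f. f \<in> A \<Longrightarrow> shift f \<in> A"
  shows "anqie A"
  unfolding anqie_def using assms by (intro conjI ballI allI impI)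

lemma anqie_slow: "anqie {f \<in> linfty. slow {f}}" (is "anqie ?Z")
proof -
  have add: "(\<lambda>n. f n + g n) \<in> ?Z" if fg: "f \<in> ?Z" "g \<in> ?Z" for f g
  proof -
    obtain B C where B: "\<And>n. norm (f n) \<le> B" and C: "\<And>n. norm (g n) \<le> C"
      using linfty_bound[of f] linfty_bound[of g] fg by auto
    have "norm (f n + g n) \<le> B + C" for n
      using norm_triangle_ineq[of "f n" "g n"] B[of n] C[of n] by linarith
    moreover have "slow {\<lambda>n. f n + g n}"
    proof (rule slow_transfer)
      fix e :: real assume "e > 0"
      moreover have "slow {f, g}" using fg slow_finite[of "{f, g}"] by blast
      moreover have "dist (f m + g m) (f m' + g m') \<le> e"
        if "dist (f m) (f m') \<le> e/2" "dist (g m) (g m') \<le> e/2" for m m'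
        using that dist_triangle_add[of "f m" "g m" "f m'" "g m'"] by linarith
      ultimately show "\<exists>F d. d > 0 \<and> slow F \<and>
        (\<forall>m m'. (\<forall>f\<in>F. dist (f m) (f m') \<le> d) \<longrightarrow> dist (f m + g m) (f m' + g m') \<le> e)"
        by (intro exI[of _ "{f, g}"] exI[of _ "e/2"]) auto
    qed
    ultimately show ?thesis by (auto intro: linftyI)
  qed
  have mult: "(\<lambda>n. f n * g n) \<in> ?Z" if fg: "f \<in> ?Z" "g \<in> ?Z" for f g
  proof -
    obtain B C where B: "B > 0" "\<And>n. norm (f n) \<le> B" and C: "C > 0" "\<And>n. norm (g n) \<le> C"
      using linfty_bound[of f] linfty_bound[of g] fg by auto
    have "norm (f n * g n) \<le> B * C" for n
      using B C by (simp add: norm_mult mult_mono less_imp_le)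
    moreover have "slow {\<lambda>n. f n * g n}"
    proof (rule slow_transfer)
      fix e :: real assume e: "e > 0"
      moreover have "slow {f, g}" using fg slow_finite[of "{f, g}"] by blast
      \<comment> \<open>The tolerance comes from splitting the difference of products and bounding
        \<open>f\<close> by \<open>B\<close> and \<open>g\<close> by \<open>C\<close>.\<close>
      moreover have "dist (f m * g m) (f m' * g m') \<le> e"
        if f: "dist (f m) (f m') \<le> e / (B + C)" and g: "dist (g m) (g m') \<le> e / (B + C)" for m m'
      proof -
        have "f m * g m - f m' * g m' = (f m - f m') * g m + f m' * (g m - g m')"
          by (simp add: algebra_simps)
        then have "dist (f m * g m) (f m' * g m') \<le>
            norm (f m - f m') * norm (g m) + norm (f m') * norm (g m - g m')"
          unfolding dist_norm by (metis norm_mult norm_triangle_ineq)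
        also have "\<dots> \<le> e / (B + C) * C + B * (e / (B + C))"
          using B C f g e unfolding dist_norm by (intro add_mono mult_mono) auto
        also have "\<dots> = e / (B + C) * (B + C)" by (simp only: algebra_simps)
        also have "\<dots> = e" using B C by simp
        finally show ?thesis .
      qed
      ultimately show "\<exists>F d. d > 0 \<and> slow F \<and>
        (\<forall>m m'. (\<forall>f\<in>F. dist (f m) (f m') \<le> d) \<longrightarrow> dist (f m * g m) (f m' * g m') \<le> e)"
        using B C by (intro exI[of _ "{f, g}"] exI[of _ "e / (B + C)"]) auto
    qed
    ultimately show ?thesis by (auto intro: linftyI)
  qed
  have const: "(\<lambda>n. c) \<in> ?Z" for c
  proof -
    have "slow {\<lambda>n. c}"
      \<comment> \<open>The empty family already controls a constant.\<close>
      by (rule slow_transfer) (use slow_empty in \<open>auto intro!: exI[of _ "{}"] exI[of _ "1::real"]\<close>)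
    then show ?thesis by (auto intro: linftyI)
  qed
  have cnj: "(\<lambda>n. cnj (f n)) \<in> ?Z" if "f \<in> ?Z" for f
  proof -
    have "slow {\<lambda>n. cnj (f n)}"
    proof (rule slow_transfer)
      fix e :: real assume "e > 0"
      then show "\<exists>F d. d > 0 \<and> slow F \<and>
        (\<forall>m m'. (\<forall>f\<in>F. dist (f m) (f m') \<le> d) \<longrightarrow> dist (cnj (f m)) (cnj (f m')) \<le> e)"
        using that by (intro exI[of _ "{f}"] exI[of _ e])
          (auto simp: dist_norm simp flip: complex_cnj_diff)
    qed
    then show ?thesis using that by (auto simp: linfty_def bounded_iff)
  qed
  have closed: "g \<in> ?Z"
    if g: "g \<in> linfty" and ex: "\<forall>e>0. \<exists>f\<in>?Z. \<forall>n. norm (f n - g n) \<le> e" for g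
  proof -
    have "slow {g}"
    proof (rule slow_transfer)
      fix e :: real assume e: "e > 0"
      then obtain f where f: "f \<in> ?Z" "\<And>n. norm (f n - g n) \<le> e/3"
        using ex by (meson divide_pos_pos zero_less_numeral)
      have "dist (g m) (g m') \<le> e" if "dist (f m) (f m') \<le> e/3" for m m'
        using that f(2)[of m] f(2)[of m']
          dist_triangle[of "g m" "g m'" "f m"] dist_triangle[of "f m" "g m'" "f m'"]
        by (auto simp: dist_norm norm_minus_commute)
      then show "\<exists>F d. d > 0 \<and> slow F \<and>
        (\<forall>m m'. (\<forall>f\<in>F. dist (f m) (f m') \<le> d) \<longrightarrow> dist (g m) (g m') \<le> e)"
        using f e by (intro exI[of _ "{f}"] exI[of _ "e/3"]) auto
    qed
    then show ?thesis using g by auto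
  qed
  have shift: "shift f \<in> ?Z" if "f \<in> ?Z" for f
  proof -
    \<comment> \<open>Closeness of \<open>f\<close> at two positions says nothing about
      \<open>shift f\<close> there, so \<open>slow_transfer\<close> does not fit; the code of
      \<open>f\<close> is read one position later instead.\<close>
    have "block_code {shift f} e n N" if code_f: "block_code {f} e n N" for e n N
    proof -
      obtain c where c: "\<And>m. c m < N"
        "\<And>m m' i. \<lbrakk>c m = c m'; i < n\<rbrakk> \<Longrightarrow> dist (f (m + i)) (f (m' + i)) \<le> e"
        using code_f unfolding block_code_def by blast
      show ?thesis
        unfolding block_code_def shift_def
        using c(1) c(2)[of "Suc _" "Suc _"] by (intro exI[of _ "\<lambda>m. c (Suc m)"]) auto
    qed
    note code_shift = this
    have slow_f: "slow {f}" using that by auto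
    have "slow {shift f}"
      unfolding slow_def
    proof (intro allI impI)
      fix e d :: real assume "e > 0" "d > 0"
      from slowD[OF slow_f this]
      show "\<forall>\<^sub>F n in sequentially. \<exists>N. block_code {shift f} e n N \<and> real N \<le> exp (d * real n)"
        by eventually_elim (use code_shift in blast)
    qed
    moreover have "shift f \<in> linfty"
      using that unfolding linfty_def bounded_iff shift_def by auto
    ultimately show ?thesis by auto
  qed
  have smult: "(\<lambda>n. c * f n) \<in> ?Z" if "f \<in> ?Z" for c f
    using mult[OF const that] .
  show ?thesis
    by (rule anqieI[OF _ const add mult smult cnj closed shift]) blast
qed

section \<open>Characters of an anqie\<close>

lemma anqieD:
  assumes "anqie A"
  shows anqie_linfty: "f \<in> A \<Longrightarrow> f \<in> linfty"
    and anqie_one: "(\<lambda>n. 1) \<in> A"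
    and anqie_add: "f \<in> A \<Longrightarrow> g \<in> A \<Longrightarrow> (\<lambda>n. f n + g n) \<in> A"
    and anqie_mult: "f \<in> A \<Longrightarrow> g \<in> A \<Longrightarrow> (\<lambda>n. f n * g n) \<in> A"
    and anqie_smult: "f \<in> A \<Longrightarrow> (\<lambda>n. c * f n) \<in> A"
    and anqie_cnj: "f \<in> A \<Longrightarrow> (\<lambda>n. cnj (f n)) \<in> A"
    and anqie_limit: "g \<in> linfty \<Longrightarrow> (\<And>e. e > 0 \<Longrightarrow> \<exists>f\<in>A. \<forall>n. norm (f n - g n) \<le> e) \<Longrightarrow> g \<in> A"
    and anqie_shift: "f \<in> A \<Longrightarrow> shift f \<in> A"
  using assms unfolding anqie_def by blast+

lemma anqie_const: "anqie A \<Longrightarrow> (\<lambda>n. c) \<in> A"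
  using anqie_smult[OF _ anqie_one, of A c] by simp

lemma anqie_diff: "anqie A \<Longrightarrow> f \<in> A \<Longrightarrow> g \<in> A \<Longrightarrow> (\<lambda>n. f n - g n) \<in> A"
  using anqie_add[of A f "\<lambda>n. -1 * g n"] anqie_smult[of A g "-1"] by simp

lemma anqie_power: "anqie A \<Longrightarrow> f \<in> A \<Longrightarrow> (\<lambda>n. f n ^ k) \<in> A"
  by (induction k) (auto intro: anqie_one anqie_mult)

lemma anqie_sum:
  assumes "anqie A" "finite I" "\<And>i. i \<in> I \<Longrightarrow> f i \<in> A"
  shows "(\<lambda>n. \<Sum>i\<in>I. f i n) \<in> A"
  using assms(2,3)
  by (induction I rule: finite_induct) (auto intro: anqie_const[OF assms(1)] anqie_add[OF assms(1)])

lemma anqie_shift_funpow: "anqie A \<Longrightarrow> f \<in> A \<Longrightarrow> (shift ^^ i) f \<in> A"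
  by (induction i) (auto intro: anqie_shift)

lemma shift_funpow: "(shift ^^ i) f m = f (m + i)"
  by (induction i arbitrary: m) (auto simp: shift_def)

lemma characterD:
  assumes "character A \<rho>"
  shows character_add: "f \<in> A \<Longrightarrow> g \<in> A \<Longrightarrow> \<rho> (\<lambda>n. f n + g n) = \<rho> f + \<rho> g"
    and character_smult: "f \<in> A \<Longrightarrow> \<rho> (\<lambda>n. c * f n) = c * \<rho> f"
    and character_mult: "f \<in> A \<Longrightarrow> g \<in> A \<Longrightarrow> \<rho> (\<lambda>n. f n * g n) = \<rho> f * \<rho> g"
    and character_one: "\<rho> (\<lambda>n. 1) = 1"
    and character_outside: "g \<notin> A \<Longrightarrow> \<rho> g = 0"
  using assms unfolding character_def by blast+

lemma character_const: "anqie A \<Longrightarrow> character A \<rho> \<Longrightarrow> \<rho> (\<lambda>n. c) = c"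
  using character_smult[of A \<rho> "\<lambda>n. 1" c] by (simp add: anqie_one character_one)

lemma character_diff:
  "\<lbrakk>anqie A; character A \<rho>; f \<in> A; g \<in> A\<rbrakk> \<Longrightarrow> \<rho> (\<lambda>n. f n - g n) = \<rho> f - \<rho> g"
  using character_add[of A \<rho> f "\<lambda>n. -1 * g n"] anqie_smult[of A g "-1"]
    character_smult[of A \<rho> g "-1"] by simp

lemma character_sum:
  assumes "anqie A" "character A \<rho>" "finite I" "\<And>i. i \<in> I \<Longrightarrow> f i \<in> A"
  shows "\<rho> (\<lambda>n. \<Sum>i\<in>I. f i n) = (\<Sum>i\<in>I. \<rho> (f i))"
  using assms(3,4)
proof (induction I rule: finite_induct)
  case empty
  show ?case using character_const[OF assms(1,2), of 0] by simp
next
  case (insert x I)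
  then show ?case
    using character_add[OF assms(2), of "f x" "\<lambda>n. \<Sum>i\<in>I. f i n"] anqie_sum[OF assms(1), of I f]
    by simp
qed

text \<open>The Neumann series makes \<open>1 - u\<close> invertible in \<open>A\<close>.\<close>
lemma character_contraction:
  assumes A: "anqie A" and \<rho>: "character A \<rho>" and u: "u \<in> A"
    and q: "q < 1" "\<And>n. norm (u n) \<le> q"
  shows "\<rho> u \<noteq> 1"
proof
  assume 1: "\<rho> u = 1"
  define v where "v n = 1 / (1 - u n)" for n
  have q0: "q \<ge> 0" using q(2)[of 0] norm_ge_zero[of "u 0"] by linarith
  have lower: "norm (1 - u n) \<ge> 1 - q" for n
    using q(2)[of n] norm_triangle_ineq2[of 1 "u n"] by simp
  then have nz: "1 - u n \<noteq> 0" for n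
    using q(1) by (metis diff_gt_0_iff_gt leD norm_zero)
  have bound: "norm (v n) \<le> 1 / (1 - q)" for n
    unfolding v_def norm_divide using lower[of n] q(1) by (simp add: frac_le)
  have "v \<in> A"
  proof (rule anqie_limit[OF A])
    show "v \<in> linfty" using bound by (rule linftyI)
    fix e :: real assume e: "e > 0"
    have "(\<lambda>k. q ^ k * (1 / (1 - q))) \<longlonglongrightarrow> 0 * (1 / (1 - q))"
      using q q0 by (intro tendsto_mult LIMSEQ_power_zero) auto
    then have "\<forall>\<^sub>F k in sequentially. q ^ k * (1 / (1 - q)) < e"
      using e by (intro order_tendstoD) auto
    then obtain k where k: "q ^ k * (1 / (1 - q)) < e"
      unfolding eventually_sequentially by blast
    have "norm ((\<Sum>j<k. u n ^ j) - v n) \<le> e" for n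
    proof -
      have "(\<Sum>j<k. u n ^ j) - v n = - (u n ^ k * v n)"
        using one_diff_power_eq[of "u n" k] nz[of n] unfolding v_def by (simp add: field_simps)
      then have "norm ((\<Sum>j<k. u n ^ j) - v n) = norm (u n) ^ k * norm (v n)"
        by (simp add: norm_mult norm_power)
      also have "\<dots> \<le> q ^ k * (1 / (1 - q))"
        using bound[of n] q(2)[of n] q0 by (intro mult_mono power_mono) auto
      finally show ?thesis using k by linarith
    qed
    moreover have "(\<lambda>n. \<Sum>j<k. u n ^ j) \<in> A"
      using anqie_sum[OF A, of "{..<k}" "\<lambda>j n. u n ^ j"] anqie_power[OF A u] by simp
    ultimately show "\<exists>f\<in>A. \<forall>n. norm (f n - v n) \<le> e"
      by (intro bexI[of _ "\<lambda>n. \<Sum>j<k. u n ^ j"]) auto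
  qed
  have "\<rho> (\<lambda>n. v n * (1 - u n)) = \<rho> v * (1 - \<rho> u)"
    using character_mult[OF \<rho> \<open>v \<in> A\<close>, of "\<lambda>n. 1 - u n"] u
      anqie_diff[OF A anqie_one[OF A] u] character_diff[OF A \<rho> anqie_one[OF A] u]
    by (simp add: character_one[OF \<rho>])
  moreover have "(\<lambda>n. v n * (1 - u n)) = (\<lambda>n. 1)"
    using nz unfolding v_def by simp
  ultimately show False using 1 character_one[OF \<rho>] by simp
qed

text \<open>Otherwise \<open>h = \<Sum>g\<in>G. \<bar>g - \<rho> g\<bar>\<^sup>2\<close> lies in the kernel of \<open>\<rho>\<close>
  but is bounded away from 0.\<close>
lemma character_approx:
  assumes A: "anqie A" and \<rho>: "character A \<rho>" and G: "finite G" "G \<subseteq> A" and e: "e > 0"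
  shows "\<exists>m. \<forall>g\<in>G. dist (\<rho> g) (g m) < e"
proof (rule ccontr)
  assume "\<not> ?thesis"
  then have far: "\<exists>g\<in>G. norm (g m - \<rho> g) \<ge> e" for m
    by (metis dist_commute dist_norm linorder_not_less)
  \<comment> \<open>Squared moduli are written as products with conjugates, which puts
    \<open>h\<close> in \<open>A\<close>; \<open>r\<close> is the same function with real values,
    for the estimates.\<close>
  define h where "h m = (\<Sum>g\<in>G. (g m - \<rho> g) * cnj (g m - \<rho> g))" for m
  define r where "r m = (\<Sum>g\<in>G. (norm (g m - \<rho> g))\<^sup>2)" for m
  have hr: "h m = of_real (r m)" for m
    unfolding h_def r_def of_real_sum by (intro sum.cong refl) (metis complex_norm_square)
  have dA: "(\<lambda>m. g m - \<rho> g) \<in> A" if "g \<in> G" for g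
    using that G anqie_diff[OF A] anqie_const[OF A] by blast
  have hA: "h \<in> A"
    unfolding h_def[abs_def]
    by (rule anqie_sum[OF A \<open>finite G\<close>, of "\<lambda>g m. (g m - \<rho> g) * cnj (g m - \<rho> g)"])
      (intro anqie_mult[OF A] anqie_cnj[OF A] dA)
  \<comment> \<open>The first factor is killed by \<rho>, hence so is the product, whatever the
    value on the conjugate.\<close>
  have "\<rho> (\<lambda>m. (g m - \<rho> g) * cnj (g m - \<rho> g)) = 0" if "g \<in> G" for g
    using character_mult[OF \<rho> dA[OF that] anqie_cnj[OF A dA[OF that]]]
      character_diff[OF A \<rho> _ anqie_const[OF A], of g "\<rho> g"] character_const[OF A \<rho>] that G
    by auto
  then have h0: "\<rho> h = 0"
    unfolding h_def[abs_def]
    using character_sum[OF A \<rho> \<open>finite G\<close>, of "\<lambda>g m. (g m - \<rho> g) * cnj (g m - \<rho> g)"]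
      anqie_mult[OF A] anqie_cnj[OF A] dA by (simp del: complex_cnj_diff)
  obtain M where M: "M > 0" "\<And>n. norm (h n) \<le> M"
    using linfty_bound[OF anqie_linfty[OF A hA]] by auto
  have r_ge: "r m \<ge> e\<^sup>2" for m
  proof -
    obtain g where g: "g \<in> G" "norm (g m - \<rho> g) \<ge> e" using far by blast
    then have "e\<^sup>2 \<le> (norm (g m - \<rho> g))\<^sup>2" using e by (intro power_mono) auto
    also have "\<dots> \<le> r m" unfolding r_def using g G by (intro member_le_sum) auto
    finally show ?thesis .
  qed
  have r_le: "r m \<le> M" for m using M(2)[of m] r_ge[of m] unfolding hr by auto
  \<comment> \<open>Dividing by the upper bound \<open>M\<close> places \<open>u\<close> between 0
    and \<open>1 - e\<^sup>2 / M\<close>, while \<rho> sends it to 1, against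
    \<open>character_contraction\<close>.\<close>
  define c where "c = complex_of_real (1 / M)"
  define u where "u n = 1 - c * h n" for n
  have "u \<in> A" unfolding u_def[abs_def]
    by (intro anqie_diff[OF A anqie_one[OF A]] anqie_smult[OF A hA])
  moreover have "\<rho> u = 1" unfolding u_def[abs_def]
    using character_diff[OF A \<rho> anqie_one[OF A] anqie_smult[OF A hA]]
      character_smult[OF \<rho> hA] h0 character_one[OF \<rho>] by simp
  moreover have "norm (u n) \<le> 1 - e\<^sup>2 / M" for n
  proof -
    have "u n = of_real (1 - r n / M)" unfolding u_def hr c_def by simp
    then have "norm (u n) = \<bar>1 - r n / M\<bar>" by (simp only: norm_of_real)
    also have "\<dots> = 1 - r n / M" using r_le[of n] M by simp
    also have "\<dots> \<le> 1 - e\<^sup>2 / M" using r_ge[of n] M by (simp add: divide_right_mono)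
    finally show ?thesis .
  qed
  moreover have "1 - e\<^sup>2 / M < 1" using M e by simp
  ultimately show False using character_contraction[OF A \<rho>] by blast
qed

text \<open>Continuity is not built into \<open>character\<close>; it comes from
  \<open>character_approx\<close>, by which the value at \<open>f\<close> is a limit of values
  \<open>f m\<close>.\<close>

lemma character_norm_le:
  assumes "anqie A" "character A \<rho>" "f \<in> A" "\<And>n. norm (f n) \<le> B"
  shows "norm (\<rho> f) \<le> B"
proof (rule field_le_epsilon)
  fix e :: real assume "e > 0"
  then obtain m where "dist (\<rho> f) (f m) < e"
    using character_approx[OF assms(1,2), of "{f}" e] assms(3) by auto
  then show "norm (\<rho> f) \<le> B + e"
    using assms(4)[of m] norm_triangle_ineq2[of "\<rho> f" "f m"] unfolding dist_norm by linarith
qed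

text \<open>The value 0 outside \<open>A\<close> is the normal form that \<open>character\<close>
  prescribes, so evaluations are honest points of the maximal ideal space.\<close>

definition point_eval :: "seq set \<Rightarrow> nat \<Rightarrow> seq \<Rightarrow> complex" where
  "point_eval A m = (\<lambda>f. if f \<in> A then f m else 0)"

lemma character_point_eval: "anqie A \<Longrightarrow> character A (point_eval A m)"
  unfolding character_def point_eval_def
  by (auto simp: anqie_add anqie_mult anqie_smult anqie_one)

section \<open>The induced map and the weak* topology\<close>

lemma topspace_max_ideal_space: "topspace (max_ideal_space A) = {\<rho>. character A \<rho>}"
  unfolding max_ideal_space_def by simp

lemma character_induced_map:
  assumes "anqie A" "character A \<rho>"
  shows "character A (induced_map A \<rho>)"
proof -
  have [simp]: "shift (\<lambda>n. f n + g n) = (\<lambda>n. shift f n + shift g n)"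
    "shift (\<lambda>n. f n * g n) = (\<lambda>n. shift f n * shift g n)"
    "shift (\<lambda>n. c * f n) = (\<lambda>n. c * shift f n)" "shift (\<lambda>n. c) = (\<lambda>n. c)" for f g c
    by (auto simp: shift_def)
  show ?thesis
    using assms unfolding character_def[of A "induced_map A \<rho>"] unfolding induced_map_def
    by (auto simp: anqie_add anqie_mult anqie_smult anqie_one anqie_shift
        character_add character_mult character_smult character_one)
qed

lemma character_induced_map_funpow:
  assumes "anqie A" "character A \<rho>"
  shows "character A ((induced_map A ^^ i) \<rho>)"
  by (induction i) (auto intro: character_induced_map assms)

lemma induced_map_funpow_apply:
  assumes "anqie A" "g \<in> A"
  shows "(induced_map A ^^ i) \<rho> g = \<rho> ((shift ^^ i) g)"
  using assms(2)
proof (induction i arbitrary: g)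
  case (Suc i)
  have "(induced_map A ^^ Suc i) \<rho> g = (induced_map A ^^ i) \<rho> (shift g)"
    using Suc.prems by (simp add: induced_map_def)
  then show ?case
    using Suc.IH[of "shift g"] Suc.prems anqie_shift[OF assms(1)] by (simp add: funpow_swap1)
qed simp

lemma induced_map_point_eval:
  "anqie A \<Longrightarrow> (induced_map A ^^ i) (point_eval A m) = point_eval A (m + i)"
  by (induction i) (auto simp: induced_map_def point_eval_def shift_def anqie_shift[unfolded shift_def])

text \<open>Tychonoff: by \<open>character_norm_le\<close> the characters lie in a product of closed
  discs, with factor \<open>{0}\<close> outside \<open>A\<close>, and the algebraic conditions
  defining them are closed.\<close>

lemma compact_characters:
  assumes A: "anqie A"
  shows "compact {\<rho>. character A \<rho>}"
proof -
  obtain B where B: "\<And>f n. f \<in> A \<Longrightarrow> norm (f n) \<le> B f"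
    using linfty_bound anqie_linfty[OF A] by metis
  define K where "K = PiE UNIV (\<lambda>f. if f \<in> A then cball (0::complex) (B f) else {0})"
  have "compactin (product_topology (\<lambda>i::seq. euclidean::complex topology) UNIV) K"
    unfolding K_def compactin_PiE by auto
  then have "compact K"
    by (simp add: euclidean_product_topology)
  moreover have "{\<rho>. character A \<rho>} \<subseteq> K"
    using character_norm_le[OF A _ _ B] unfolding K_def
    by (auto simp: character_outside split: if_splits)
  moreover have "closed {\<rho>. character A \<rho>}"
  proof -
    have [continuous_intros]: "continuous_on UNIV (\<lambda>\<rho>::seq\<Rightarrow>complex. \<rho> f)" for f
      by (rule continuous_on_product_coordinates)
    show ?thesis
      unfolding character_def Ball_def
      by (intro closed_Collect_conj closed_Collect_all closed_Collect_imp closed_Collect_eq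
          open_Collect_const continuous_intros)
  qed
  ultimately show ?thesis
    by (metis compact_Int_closed inf.absorb_iff2)
qed

text \<open>A basic open set of the product restricts only finitely many coordinates, and a common
  radius is the least of finitely many.\<close>

lemma open_character_nhd:
  assumes "open W" "x \<in> W" "character A x"
  shows "\<exists>F e. finite F \<and> F \<subseteq> A \<and> e > 0 \<and>
     (\<forall>y. character A y \<longrightarrow> (\<forall>f\<in>F. dist (y f) (x f) < e) \<longrightarrow> y \<in> W)"
proof -
  have "openin (product_topology (\<lambda>i::seq. euclidean::complex topology) UNIV) W"
    using assms(1) by (simp add: euclidean_product_topology)
  from product_topology_open_contains_basis[OF this \<open>x \<in> W\<close>]
  have "\<exists>U. finite {i. U i \<noteq> UNIV} \<and> (\<forall>i. open (U i)) \<and> x \<in> PiE UNIV U \<and> PiE UNIV U \<subseteq> W"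
    by auto
  then obtain U where "finite {i. U i \<noteq> UNIV}" "\<forall>i. open (U i)" "x \<in> PiE UNIV U" "PiE UNIV U \<subseteq> W"
    by blast
  then have U: "finite {i. U i \<noteq> UNIV}" "\<And>i. open (U i)" "\<And>i. x i \<in> U i"
    "\<And>y. (\<And>i. y i \<in> U i) \<Longrightarrow> y \<in> W"
    by (auto simp: PiE_UNIV_domain Pi_def)
  have "\<forall>i. \<exists>d>0. \<forall>z. dist z (x i) < d \<longrightarrow> z \<in> U i"
    using U(2,3) unfolding open_dist by blast
  then obtain d where "\<forall>i. d i > 0 \<and> (\<forall>z. dist z (x i) < d i \<longrightarrow> z \<in> U i)"
    using choice[of "\<lambda>i d. d > 0 \<and> (\<forall>z. dist z (x i) < d \<longrightarrow> z \<in> U i)"] by blast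
  then have d: "\<And>i. d i > 0" "\<And>i z. dist z (x i) < d i \<Longrightarrow> z \<in> U i" by auto
  define F where "F = {i. U i \<noteq> UNIV} \<inter> A"
  \<comment> \<open>The inserted 1 keeps the minimum defined when \<open>F\<close> is empty.\<close>
  define e where "e = Min (insert 1 (d ` F))"
  have "finite F" using U(1) unfolding F_def by simp
  then have e: "e > 0" "\<And>i. i \<in> F \<Longrightarrow> e \<le> d i" unfolding e_def using d(1) by auto
  have "y \<in> W" if y: "character A y" "\<forall>f\<in>F. dist (y f) (x f) < e" for y
  proof (rule U(4))
    fix i
    show "y i \<in> U i"
    proof (cases "U i \<noteq> UNIV \<and> i \<in> A")
      case True
      then have "i \<in> F" unfolding F_def by simp
      then show ?thesis using y(2) e(2)[of i] d(2)[of "y i" i] by force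
    next
      case False
      then show ?thesis
        using U(3)[of i] y(1) \<open>character A x\<close> by (auto simp: character_outside)
    qed
  qed
  moreover have "F \<subseteq> A" unfolding F_def by simp
  ultimately show ?thesis using \<open>finite F\<close> e(1) by blast
qed

text \<open>No metric is chosen on the maximal ideal space; a finite set \<open>F\<close> of test
  functions with one radius \<open>e\<close> plays the part of the Lebesgue number.\<close>

lemma character_Lebesgue_number:
  assumes A: "anqie A" and \<U>: "open_cover (max_ideal_space A) \<U>"
  shows "\<exists>F e. finite F \<and> F \<subseteq> A \<and> e > 0 \<and>
     (\<forall>y. character A y \<longrightarrow> (\<exists>U\<in>\<U>. \<forall>z. character A z \<longrightarrow> (\<forall>f\<in>F. dist (z f) (y f) < e) \<longrightarrow> z \<in> U))"
proof -
  define X where "X = {\<rho>. character A \<rho>}"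
  have "\<exists>F e U. finite F \<and> F \<subseteq> A \<and> e > 0 \<and> U \<in> \<U> \<and>
     (\<forall>y. character A y \<longrightarrow> (\<forall>f\<in>F. dist (y f) (x f) < e) \<longrightarrow> y \<in> U)" if x: "x \<in> X" for x
  proof -
    obtain U where U: "U \<in> \<U>" "x \<in> U"
      using \<U> x unfolding open_cover_def topspace_max_ideal_space X_def by blast
    then obtain W where W: "open W" "U = W \<inter> X"
      using \<U> unfolding open_cover_def max_ideal_space_def X_def
      by (force simp: openin_subtopology)
    then show ?thesis
      using open_character_nhd[of W x A] U x unfolding X_def by blast
  qed
  then obtain F e U where FeU: "\<And>x. x \<in> X \<Longrightarrow> finite (F x) \<and> F x \<subseteq> A \<and> e x > 0 \<and> U x \<in> \<U> \<and>
     (\<forall>y. character A y \<longrightarrow> (\<forall>f\<in>F x. dist (y f) (x f) < e x) \<longrightarrow> y \<in> U x)"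
    by metis
  \<comment> \<open>Halved radii leave room for the triangle inequality, from \<open>z\<close> to
    \<open>y\<close> to the centre \<open>x\<close>.\<close>
  define N where "N x = (\<Inter>f\<in>F x. {y. dist (y f) (x f) < e x / 2})" for x
  have "open (N x)" if "x \<in> X" for x
    unfolding N_def using FeU[OF that]
    by (intro open_INT ballI open_Collect_less continuous_intros continuous_on_product_coordinates) auto
  moreover have "X \<subseteq> (\<Union>x\<in>X. N x)"
    using FeU unfolding N_def by fastforce
  ultimately obtain X0 where X0: "X0 \<subseteq> X" "finite X0" "X \<subseteq> (\<Union>x\<in>X0. N x)"
    using compactE_image[OF compact_characters[OF A, folded X_def], of X N] by blast
  define d where "d = Min (insert 1 ((\<lambda>x. e x / 2) ` X0))"
  have "d > 0" unfolding d_def using X0 FeU by auto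
  moreover have "d \<le> e x / 2" if "x \<in> X0" for x
    unfolding d_def using X0 that by (intro Min_le) auto
  ultimately have d: "d > 0" "\<And>x. x \<in> X0 \<Longrightarrow> d \<le> e x / 2" by blast+
  have "\<exists>U\<in>\<U>. \<forall>z. character A z \<longrightarrow> (\<forall>f\<in>\<Union>(F ` X0). dist (z f) (y f) < d) \<longrightarrow> z \<in> U"
    if y: "character A y" for y
  proof -
    obtain x where x: "x \<in> X0" "y \<in> N x" using X0(3) y unfolding X_def by blast
    have "z \<in> U x" if z: "character A z" "\<forall>f\<in>\<Union>(F ` X0). dist (z f) (y f) < d" for z
    proof -
      have "dist (z f) (x f) < e x" if f: "f \<in> F x" for f
      proof -
        have "dist (z f) (y f) < e x / 2" using z(2) d(2)[OF x(1)] f x(1) by force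
        moreover have "dist (y f) (x f) < e x / 2" using x(2) f unfolding N_def by auto
        ultimately show ?thesis using dist_triangle[of "z f" "x f" "y f"] by linarith
      qed
      then show ?thesis using FeU x(1) X0(1) z(1) by blast
    qed
    then show ?thesis using FeU x(1) X0(1) by blast
  qed
  moreover have "finite (F x)" "F x \<subseteq> A" if "x \<in> X0" for x using X0(1) FeU that by blast+
  then have "finite (\<Union>(F ` X0))" "\<Union>(F ` X0) \<subseteq> A" using X0(2) by auto
  ultimately show ?thesis using d(1) by blast
qed

section \<open>Entropy zero means slow\<close>

text \<open>Fekete's lemma. Entropy of a cover is defined through \<open>lim\<close>, which is
  informative only once convergence is known.\<close>

lemma fekete_convergent:
  fixes a :: "nat \<Rightarrow> real"
  assumes sub: "\<And>m n. a (m + n) \<le> a m + a n" and nonneg: "\<And>n. a n \<ge> 0"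
  shows "convergent (\<lambda>n. a n / real n)"
proof -
  define L where "L = Inf ((\<lambda>n. a n / real n) ` {1..})"
  have bdd: "bdd_below ((\<lambda>n. a n / real n) ` {1..})"
    by (rule bdd_belowI[of _ 0]) (use nonneg in auto)
  have lower: "L \<le> a n / real n" if "n \<ge> 1" for n
    unfolding L_def by (rule cInf_lower[OF _ bdd]) (use that in auto)
  have mult: "a (q * k + r) \<le> real q * a k + a r" for q k r
  proof (induction q)
    case (Suc q)
    have "a (Suc q * k + r) \<le> a k + a (q * k + r)"
      using sub[of k "q * k + r"] by (simp add: add.assoc)
    then show ?case using Suc by (simp add: algebra_simps)
  qed simp
  have "(\<lambda>n. a n / real n) \<longlonglongrightarrow> L"
  proof (rule LIMSEQ_I)
    fix e :: real assume e: "e > 0"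
    obtain k where k: "k \<ge> 1" "a k / real k < L + e / 2"
      using cInf_lessD[of "(\<lambda>n. a n / real n) ` {1..}" "L + e/2"] e unfolding L_def by auto
    \<comment> \<open>One bound for the contribution of every remainder modulo \<open>k\<close>,
      independent of \<open>n\<close>.\<close>
    define M where "M = (\<Sum>r<k. a r)"
    obtain n0 :: nat where n0: "real n0 > M / (e / 2)" using reals_Archimedean2 by blast
    have "norm (a n / real n - L) < e" if n: "n \<ge> Suc n0" for n
    proof -
      have npos: "real n > 0" using n by simp
      have "a n \<le> real (n div k) * a k + a (n mod k)"
        using mult[of "n div k" k "n mod k"] by simp
      also have "a (n mod k) \<le> M"
        unfolding M_def using k nonneg by (intro member_le_sum) auto
      also have "real (n div k) * a k \<le> real n / real k * a k"
        using nonneg by (intro mult_right_mono of_nat_div_le_of_nat) auto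
      finally have "a n / real n \<le> (real n / real k * a k + M) / real n"
        using npos by (intro divide_right_mono) auto
      also have "\<dots> = a k / real k + M / real n" using npos by (simp add: add_divide_distrib)
      also have "M / real n < e / 2"
      proof -
        have "M < real n0 * (e / 2)" using n0 e by (simp add: field_simps)
        also have "\<dots> \<le> real n * (e / 2)" using n e by (intro mult_right_mono) auto
        finally show ?thesis using npos by (simp add: field_simps)
      qed
      finally have "a n / real n < L + e" using k by linarith
      moreover have "L \<le> a n / real n" using lower n by simp
      ultimately show ?thesis by (simp add: abs_if)
    qed
    then show "\<exists>no. \<forall>n\<ge>no. norm (a n / real n - L) < e" by blast
  qed
  then show ?thesis unfolding convergent_def by blast
qed

section \<open>Minimal subcovers and existence of the entropy limit\<close>

lemma min_subcover_card_le:
  assumes "\<W> \<subseteq> \<U>" "finite \<W>" "\<Union>\<W> = topspace X"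
  shows "min_subcover_card X \<U> \<le> card \<W>"
  unfolding min_subcover_card_def by (rule Least_le) (use assms in blast)

lemma min_subcover_card_witness:
  assumes "\<W> \<subseteq> \<U>" "finite \<W>" "\<Union>\<W> = topspace X"
  shows "\<exists>\<V>. \<V> \<subseteq> \<U> \<and> finite \<V> \<and> \<Union>\<V> = topspace X \<and> card \<V> = min_subcover_card X \<U>"
  unfolding min_subcover_card_def
  by (rule LeastI[where P = "\<lambda>k. \<exists>\<V>. \<V> \<subseteq> \<U> \<and> finite \<V> \<and> \<Union>\<V> = topspace X \<and> card \<V> = k"])
    (use assms in blast)

text \<open>Finiteness of the cover makes every iterated join finite, so minimal subcovers exist
  without appeal to compactness; a nonempty space makes their sizes at least 1 and the logarithms
  nonnegative.\<close>

locale finite_cover_dynamics =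
  fixes X :: "'a topology" and T :: "'a \<Rightarrow> 'a" and \<U> :: "'a set set"
  assumes finite_cover: "finite \<U>" and cover: "\<Union>\<U> = topspace X"
    and maps: "\<And>x. x \<in> topspace X \<Longrightarrow> T x \<in> topspace X"
    and nonempty: "topspace X \<noteq> {}"
begin

lemma maps_funpow: "x \<in> topspace X \<Longrightarrow> (T ^^ i) x \<in> topspace X"
  by (induction i) (auto intro: maps)

abbreviation "cylinder n U \<equiv> {x \<in> topspace X. \<forall>i<n. (T ^^ i) x \<in> U i}"

lemma iter_joinD: "S \<in> iter_join X T \<U> n \<Longrightarrow> \<exists>U. S = cylinder n U \<and> (\<forall>i<n. U i \<in> \<U>)"
  unfolding iter_join_def by blast

lemma finite_iter_join: "finite (iter_join X T \<U> n)"
proof -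
  have "iter_join X T \<U> n \<subseteq> cylinder n ` PiE {..<n} (\<lambda>_. \<U>)"
  proof
    fix S assume "S \<in> iter_join X T \<U> n"
    then obtain U where U: "S = cylinder n U" "\<forall>i<n. U i \<in> \<U>" using iter_joinD by blast
    \<comment> \<open>Only the first \<open>n\<close> choices matter, which leaves finitely many
      choice functions.\<close>
    then have "S = cylinder n (restrict U {..<n})" by auto
    moreover have "restrict U {..<n} \<in> PiE {..<n} (\<lambda>_. \<U>)" using U by auto
    ultimately show "S \<in> cylinder n ` PiE {..<n} (\<lambda>_. \<U>)" by blast
  qed
  then show ?thesis by (rule finite_subset) (intro finite_imageI finite_PiE finite_cover, simp)
qed

lemma Union_iter_join: "\<Union>(iter_join X T \<U> n) = topspace X"
proof
  show "\<Union>(iter_join X T \<U> n) \<subseteq> topspace X" unfolding iter_join_def by auto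
  show "topspace X \<subseteq> \<Union>(iter_join X T \<U> n)"
  proof
    fix x assume x: "x \<in> topspace X"
    have "\<exists>U. U \<in> \<U> \<and> (T ^^ i) x \<in> U" for i
      using maps_funpow[OF x, of i] cover by blast
    then obtain U where "\<And>i. U i \<in> \<U> \<and> (T ^^ i) x \<in> U i" by metis
    then have "x \<in> cylinder n U" "cylinder n U \<in> iter_join X T \<U> n"
      using x unfolding iter_join_def by auto
    then show "x \<in> \<Union>(iter_join X T \<U> n)" by blast
  qed
qed

lemma minimal_subcover:
  "\<exists>\<V>. \<V> \<subseteq> iter_join X T \<U> n \<and> finite \<V> \<and> \<Union>\<V> = topspace X \<and>
     card \<V> = min_subcover_card X (iter_join X T \<U> n)"
  by (rule min_subcover_card_witness[OF subset_refl finite_iter_join Union_iter_join])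

lemma min_subcover_card_pos: "min_subcover_card X (iter_join X T \<U> n) \<ge> 1"
proof -
  obtain \<V> where "finite \<V>" "\<Union>\<V> = topspace X" "card \<V> = min_subcover_card X (iter_join X T \<U> n)"
    using minimal_subcover[of n] by blast
  moreover from \<open>\<Union>\<V> = topspace X\<close> have "\<V> \<noteq> {}" using nonempty by (metis Union_empty)
  ultimately show ?thesis by (metis One_nat_def Suc_leI card_gt_0_iff)
qed

text \<open>Intersecting a cylinder of length \<open>m\<close> with the preimage under
  \<open>T ^^ m\<close> of one of length \<open>n\<close> gives a cylinder of length
  \<open>m + n\<close>. The logarithms are therefore subadditive.\<close>

lemma min_subcover_card_add:
  "min_subcover_card X (iter_join X T \<U> (m + n))
     \<le> min_subcover_card X (iter_join X T \<U> m) * min_subcover_card X (iter_join X T \<U> n)"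
proof -
  obtain \<V> where V: "\<V> \<subseteq> iter_join X T \<U> m" "finite \<V>" "\<Union>\<V> = topspace X"
    "card \<V> = min_subcover_card X (iter_join X T \<U> m)" using minimal_subcover[of m] by blast
  obtain \<W> where W: "\<W> \<subseteq> iter_join X T \<U> n" "finite \<W>" "\<Union>\<W> = topspace X"
    "card \<W> = min_subcover_card X (iter_join X T \<U> n)" using minimal_subcover[of n] by blast
  define J where "J = (\<lambda>(V, W). {x \<in> V. (T ^^ m) x \<in> W})"
  have "J (V, W) \<in> iter_join X T \<U> (m + n)" if VW: "V \<in> \<V>" "W \<in> \<W>" for V W
  proof -
    obtain U where U: "V = cylinder m U" "\<forall>i<m. U i \<in> \<U>"
      using iter_joinD[of V m] VW(1) V(1) by auto
    obtain U' where U': "W = cylinder n U'" "\<forall>i<n. U' i \<in> \<U>"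
      using iter_joinD[of W n] VW(2) W(1) by auto
    define U'' where "U'' i = (if i < m then U i else U' (i - m))" for i
    have "J (V, W) = cylinder (m + n) U''"
    proof (rule set_eqI)
      fix x
      have shift: "(T ^^ i) ((T ^^ m) x) = (T ^^ (m + i)) x" for i
        by (simp add: funpow_add add.commute[of m])
      show "x \<in> J (V, W) \<longleftrightarrow> x \<in> cylinder (m + n) U''"
      proof
        assume x: "x \<in> J (V, W)"
        have "(T ^^ i) x \<in> U'' i" if "i < m + n" for i
        proof (cases "i < m")
          case True then show ?thesis using x unfolding J_def U U''_def by auto
        next
          case False
          then have "(T ^^ (i - m)) ((T ^^ m) x) \<in> U' (i - m)"
            using x that unfolding J_def U' by auto
          then show ?thesis using False shift[of "i - m"] unfolding U''_def by simp
        qed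
        then show "x \<in> cylinder (m + n) U''" using x unfolding J_def U by auto
      next
        assume x: "x \<in> cylinder (m + n) U''"
        have "(T ^^ i) ((T ^^ m) x) \<in> U' i" if "i < n" for i
          using x that unfolding shift U''_def by (auto dest!: spec[of _ "m + i"])
        moreover have "(T ^^ i) x \<in> U i" if "i < m" for i
          using x that unfolding U''_def by (auto dest!: spec[of _ i])
        ultimately show "x \<in> J (V, W)" using x maps_funpow unfolding J_def U U' by auto
      qed
    qed
    moreover have "\<forall>i<m+n. U'' i \<in> \<U>" using U U' unfolding U''_def by auto
    ultimately show ?thesis unfolding iter_join_def by blast
  qed
  then have "J ` (\<V> \<times> \<W>) \<subseteq> iter_join X T \<U> (m + n)" by auto
  moreover have "\<Union>(J ` (\<V> \<times> \<W>)) = topspace X"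
  proof
    show "\<Union>(J ` (\<V> \<times> \<W>)) \<subseteq> topspace X" using V(3) unfolding J_def by auto
    show "topspace X \<subseteq> \<Union>(J ` (\<V> \<times> \<W>))"
    proof
      fix x assume x: "x \<in> topspace X"
      then obtain V W where "V \<in> \<V>" "x \<in> V" "W \<in> \<W>" "(T ^^ m) x \<in> W"
        using V(3) W(3) maps_funpow[OF x, of m] by blast
      then show "x \<in> \<Union>(J ` (\<V> \<times> \<W>))" unfolding J_def by force
    qed
  qed
  ultimately have "min_subcover_card X (iter_join X T \<U> (m + n)) \<le> card (J ` (\<V> \<times> \<W>))"
    using V W by (intro min_subcover_card_le) auto
  also have "\<dots> \<le> card (\<V> \<times> \<W>)" using V W by (intro card_image_le) auto
  finally show ?thesis using V W by (simp add: card_cartesian_product)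
qed

lemma cover_entropy_limit:
  "(\<lambda>n. ln (real (min_subcover_card X (iter_join X T \<U> n))) / real n) \<longlonglongrightarrow> cover_entropy X T \<U>"
proof -
  let ?N = "\<lambda>n. min_subcover_card X (iter_join X T \<U> n)"
  have pos: "real (?N n) \<ge> 1" for n using min_subcover_card_pos[of n] by simp
  have "ln (real (?N (m + n))) \<le> ln (real (?N m)) + ln (real (?N n))" for m n
  proof -
    have "real (?N (m + n)) \<le> real (?N m) * real (?N n)"
      using min_subcover_card_add[of m n] by (simp flip: of_nat_mult)
    then have "ln (real (?N (m + n))) \<le> ln (real (?N m) * real (?N n))"
      using pos[of "m + n"] by (intro ln_mono) linarith+
    then show ?thesis using pos[of m] pos[of n] by (subst (asm) ln_mult) auto
  qed
  moreover have "ln (real (?N n)) \<ge> 0" for n using pos[of n] by simp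
  ultimately have "convergent (\<lambda>n. ln (real (?N n)) / real n)"
    by (rule fekete_convergent)
  then show ?thesis unfolding cover_entropy_def by (simp add: convergent_LIMSEQ_iff)
qed

end

text \<open>A Lebesgue number attaches to each position \<open>m\<close> a cover member
  \<open>V m\<close> holding all characters close to evaluation at \<open>m\<close>. One cylinder
  per code label, following the orbit of a representative position, then suffices to cover the
  space.\<close>

lemma slow_cover_entropy:
  assumes A: "anqie A" and slow: "\<And>f. f \<in> A \<Longrightarrow> slow {f}"
    and \<U>: "open_cover (max_ideal_space A) \<U>"
  shows "cover_entropy (max_ideal_space A) (induced_map A) \<U> = 0"
proof -
  let ?X = "max_ideal_space A" and ?T = "induced_map A"
  let ?N = "\<lambda>n. min_subcover_card ?X (iter_join ?X ?T \<U> n)"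
  obtain F e where F: "finite F" "F \<subseteq> A" "e > 0" and
    Leb: "\<And>y. character A y \<Longrightarrow>
      \<exists>U\<in>\<U>. \<forall>z. character A z \<longrightarrow> (\<forall>f\<in>F. dist (z f) (y f) < e) \<longrightarrow> z \<in> U"
    using character_Lebesgue_number[OF A \<U>] by blast
  have "\<exists>U. U \<in> \<U> \<and> (\<forall>z. character A z \<longrightarrow> (\<forall>f\<in>F. dist (z f) (f m) < e) \<longrightarrow> z \<in> U)" for m
    using Leb[OF character_point_eval[OF A, of m]] F(2) unfolding point_eval_def
    by (auto simp: subset_iff)
  then obtain V where V: "\<And>m. V m \<in> \<U>"
    "\<And>m z. character A z \<Longrightarrow> (\<forall>f\<in>F. dist (z f) (f m) < e) \<Longrightarrow> z \<in> V m" by metis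
  have bound: "?N n \<le> N" if code: "block_code F (e/2) n N" for n N
  proof -
    obtain c where c: "\<And>m. c m < N"
      "\<And>m m' i f. \<lbrakk>c m = c m'; i < n; f \<in> F\<rbrakk> \<Longrightarrow> dist (f (m + i)) (f (m' + i)) \<le> e/2"
      using code unfolding block_code_def by blast
    define W where "W m = {x \<in> topspace ?X. \<forall>i<n. (?T ^^ i) x \<in> V (m + i)}" for m
    \<comment> \<open>One position is kept for each label, so at most \<open>N\<close> cylinders
      arise.\<close>
    define rep where "rep j = (SOME m. c m = j)" for j
    have rep: "c (rep (c m)) = c m" for m
      unfolding rep_def by (rule someI[of "\<lambda>m'. c m' = c m"]) simp
    have "W m \<in> iter_join ?X ?T \<U> n" for m
      unfolding W_def iter_join_def using V(1) by (auto intro!: exI[of _ "\<lambda>i. V (m + i)"])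
    moreover have "\<Union>((\<lambda>m. W (rep (c m))) ` UNIV) = topspace ?X"
    proof
      show "\<Union>((\<lambda>m. W (rep (c m))) ` UNIV) \<subseteq> topspace ?X" unfolding W_def by auto
      show "topspace ?X \<subseteq> \<Union>((\<lambda>m. W (rep (c m))) ` UNIV)"
      proof
        fix y assume "y \<in> topspace ?X"
        then have y: "character A y" by (simp add: topspace_max_ideal_space)
        \<comment> \<open>Testing all shifts at once yields a single position \<open>m\<close> whose
          first \<open>n\<close> orbit points shadow those of \<open>y\<close>.\<close>
        define G where "G = (\<lambda>(i, f). (shift ^^ i) f) ` ({..<n} \<times> F)"
        have "finite G" "G \<subseteq> A"
          unfolding G_def using F anqie_shift_funpow[OF A] by auto
        then obtain m where m: "\<And>g. g \<in> G \<Longrightarrow> dist (y g) (g m) < e/2"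
          using character_approx[OF A y, of G "e/2"] F(3) by auto
        have "(?T ^^ i) y \<in> V (rep (c m) + i)" if i: "i < n" for i
        proof (rule V(2))
          show "character A ((?T ^^ i) y)" by (rule character_induced_map_funpow[OF A y])
          show "\<forall>f\<in>F. dist ((?T ^^ i) y f) (f (rep (c m) + i)) < e"
          proof
            fix f assume f: "f \<in> F"
            have "(?T ^^ i) y f = y ((shift ^^ i) f)"
              using induced_map_funpow_apply[OF A] f F(2) by blast
            moreover have "dist (y ((shift ^^ i) f)) (f (m + i)) < e/2"
              using m[of "(shift ^^ i) f"] i f unfolding G_def shift_funpow by force
            ultimately have "dist ((?T ^^ i) y f) (f (m + i)) < e/2" by simp
            moreover have "dist (f (m + i)) (f (rep (c m) + i)) \<le> e/2"
              by (rule c(2)) (use rep i f in auto)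
            ultimately show "dist ((?T ^^ i) y f) (f (rep (c m) + i)) < e"
              using dist_triangle[of "(?T ^^ i) y f" "f (rep (c m) + i)" "f (m + i)"] by linarith
          qed
        qed
        then have "y \<in> W (rep (c m))"
          unfolding W_def using y by (simp add: topspace_max_ideal_space)
        then show "y \<in> \<Union>((\<lambda>m. W (rep (c m))) ` UNIV)" by blast
      qed
    qed
    moreover have sub: "(\<lambda>m. W (rep (c m))) ` UNIV \<subseteq> (\<lambda>j. W (rep j)) ` {..<N}" using c(1) by auto
    ultimately have "?N n \<le> card ((\<lambda>m. W (rep (c m))) ` UNIV)"
      by (intro min_subcover_card_le finite_subset[OF sub]) auto
    also have "\<dots> \<le> card ((\<lambda>j. W (rep j)) ` {..<N})" by (intro card_mono sub) auto
    also have "\<dots> \<le> N" using card_image_le[of "{..<N}" "\<lambda>j. W (rep j)"] by simp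
    finally show ?thesis .
  qed
  have "(\<lambda>n. ln (real (?N n)) / real n) \<longlonglongrightarrow> 0"
  proof (rule tendstoI)
    fix d :: real assume d: "d > 0"
    have "slow F" using slow_finite[OF F(1)] slow F(2) by blast
    then have "\<forall>\<^sub>F n in sequentially. \<exists>N. block_code F (e/2) n N \<and> real N \<le> exp (d/2 * real n)"
      using slowD[of F "e/2" "d/2"] F(3) d by simp
    moreover have "\<forall>\<^sub>F n::nat in sequentially. n > 0" by (rule eventually_gt_at_top)
    ultimately show "\<forall>\<^sub>F n in sequentially. dist (ln (real (?N n)) / real n) 0 < d"
    proof eventually_elim
      case (elim n)
      then have N: "real (?N n) \<le> exp (d/2 * real n)" using bound by (meson of_nat_mono order_trans)
      have "ln (real (?N n)) \<le> d/2 * real n \<and> ln (real (?N n)) \<ge> 0"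
      proof (cases "?N n = 0")
        \<comment> \<open>Here \<open>ln 0 = 0\<close> is the value in force.\<close>
        case True then show ?thesis using d by simp
      next
        case False
        then have "ln (real (?N n)) \<le> ln (exp (d/2 * real n))" using N by (intro ln_mono) auto
        then show ?thesis using False by simp
      qed
      then have "0 \<le> ln (real (?N n)) / real n" "ln (real (?N n)) / real n \<le> d/2"
        using elim by (auto simp: field_simps)
      then show ?case using d unfolding dist_norm diff_0_right real_norm_def by linarith
    qed
  qed
  then show ?thesis unfolding cover_entropy_def by (rule limI)
qed

section \<open>From entropy zero to slowness, and the description of \<open>E0_alg\<close>\<close>

lemma finite_ball_cover:
  fixes K :: "'a::metric_space set"
  assumes "compact K" "e > 0"
  shows "\<exists>Z. finite Z \<and> K \<subseteq> (\<Union>z\<in>Z. ball z e)"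
  using seq_compact_imp_totally_bounded[OF assms(1)[unfolded compact_eq_seq_compact_metric]] assms(2)
  by blast

text \<open>The cover is pulled back along \<open>f\<close> from finitely many discs of radius
  \<open>e/2\<close>. Positions whose evaluations share a cylinder have their
  \<open>f\<close>-windows in the same discs, hence within \<open>e\<close>; a minimal subcover thus
  provides the labels.\<close>

lemma slow_of_entropy_zero:
  assumes A: "anqie A" and zero: "anqie_entropy A = 0" and f: "f \<in> A"
  shows "slow {f}"
  unfolding slow_def
proof (intro allI impI)
  fix e d :: real assume e: "e > 0" and d: "d > 0"
  let ?X = "max_ideal_space A" and ?T = "induced_map A"
  obtain B where B: "\<And>n. norm (f n) \<le> B" using linfty_bound[OF anqie_linfty[OF A f]] by blast
  obtain Z :: "complex set" where Z: "finite Z" "cball 0 B \<subseteq> (\<Union>z\<in>Z. ball z (e/2))"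
    using finite_ball_cover[OF compact_cball half_gt_zero[OF e]] by blast
  define U where "U z = {\<rho>. character A \<rho> \<and> \<rho> f \<in> ball z (e/2)}" for z
  define \<U> where "\<U> = U ` Z"
  have "openin ?X (U z)" for z
  proof -
    have "open ((\<lambda>\<rho>::seq\<Rightarrow>complex. \<rho> f) -` ball z (e/2))"
      by (intro open_vimage continuous_on_product_coordinates open_ball)
    then show ?thesis
      unfolding max_ideal_space_def U_def openin_subtopology by (auto simp flip: open_openin)
  qed
  moreover have cover: "\<Union>\<U> = topspace ?X"
    using Z(2) character_norm_le[OF A _ f B]
    unfolding \<U>_def U_def topspace_max_ideal_space by (auto simp: subset_iff)
  ultimately have "open_cover ?X \<U>" unfolding open_cover_def \<U>_def by auto
  then have "ereal (cover_entropy ?X ?T \<U>) \<le> 0"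
    using zero unfolding anqie_entropy_def top_entropy_def
    by (metis (mono_tags, lifting) SUP_upper mem_Collect_eq)
  then have le0: "cover_entropy ?X ?T \<U> \<le> 0" by simp
  interpret finite_cover_dynamics ?X ?T \<U>
    using cover Z(1) character_point_eval[OF A]
    by unfold_locales (auto simp: \<U>_def topspace_max_ideal_space intro: character_induced_map[OF A])
  have "\<forall>\<^sub>F n in sequentially. ln (real (min_subcover_card ?X (iter_join ?X ?T \<U> n))) / real n < d"
    using order_tendstoD(2)[OF cover_entropy_limit, of d] le0 d by simp
  moreover have "\<forall>\<^sub>F n::nat in sequentially. n > 0" by (rule eventually_gt_at_top)
  ultimately show "\<forall>\<^sub>F n in sequentially. \<exists>N. block_code {f} e n N \<and> real N \<le> exp (d * real n)"
  proof eventually_elim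
    case (elim n)
    let ?N = "min_subcover_card ?X (iter_join ?X ?T \<U> n)"
    obtain \<V> where V: "\<V> \<subseteq> iter_join ?X ?T \<U> n" "finite \<V>" "\<Union>\<V> = topspace ?X" "card \<V> = ?N"
      using minimal_subcover[of n] by blast
    have "point_eval A m \<in> \<Union>\<V>" for m
      unfolding V(3) topspace_max_ideal_space by (simp add: character_point_eval[OF A])
    \<comment> \<open>The label of \<open>m\<close> is any member of the minimal subcover containing
      evaluation at \<open>m\<close>.\<close>
    then obtain c where c: "\<And>m. c m \<in> \<V> \<and> point_eval A m \<in> c m" unfolding Union_iff by metis
    have "block_code {f} e n ?N"
    proof (rule block_codeI[of \<V> c])
      fix m m' i g assume mm': "c m = c m'" and i: "i < n" and "g \<in> {f}"
      obtain S where S: "c m = cylinder n S" "\<forall>i<n. S i \<in> \<U>"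
          using iter_joinD[of "c m" n] c[of m] V(1) by auto
      obtain z where z: "S i = U z" using S(2) i unfolding \<U>_def by blast
      have "point_eval A (k + i) \<in> U z" if "k = m \<or> k = m'" for k
        using c[of k] S(1) mm' i z that induced_map_point_eval[OF A] by auto
      then have "dist z (f (m + i)) < e/2" "dist z (f (m' + i)) < e/2"
        using f unfolding U_def point_eval_def by auto
      then show "dist (g (m + i)) (g (m' + i)) \<le> e"
        using \<open>g \<in> {f}\<close> dist_triangle2[of "f (m + i)" "f (m' + i)" z] by (simp add: dist_commute)
    qed (use V c in auto)
    moreover have "real ?N \<le> exp (d * real n)"
    proof -
      have "ln (real ?N) \<le> d * real n" using elim by (simp add: field_simps)
      moreover have "real ?N > 0" using min_subcover_card_pos[of n] by simp
      ultimately show ?thesis by (metis exp_le_cancel_iff exp_ln)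
    qed
    ultimately show ?case by blast
  qed
qed

lemma E0_alg_eq: "E0_alg = {f \<in> linfty. slow {f}}"
proof -
  \<comment> \<open>Some anqie must contain \<open>f\<close>; otherwise the intersection in
    \<open>anqie_gen\<close> would be over the empty family and so consist of all sequences.\<close>
  have linfty: "anqie linfty"
  proof -
    have "(\<lambda>n. f n + g n) \<in> linfty" "(\<lambda>n. f n * g n) \<in> linfty" if fg: "f \<in> linfty" "g \<in> linfty" for f g
    proof -
      obtain B C where B: "B > 0" "\<And>n. norm (f n) \<le> B" and C: "C > 0" "\<And>n. norm (g n) \<le> C"
        using linfty_bound[OF fg(1)] linfty_bound[OF fg(2)] by blast
      show "(\<lambda>n. f n + g n) \<in> linfty" "(\<lambda>n. f n * g n) \<in> linfty"
        by (rule linftyI[of _ "B + C"], use B C in \<open>meson norm_triangle_le add_mono\<close>)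
          (rule linftyI[of _ "B * C"], use B C in \<open>simp add: norm_mult mult_mono less_imp_le\<close>)
    qed
    moreover have const: "(\<lambda>n. c) \<in> linfty" for c by (rule linftyI[of _ "norm c"]) simp
    moreover have "(\<lambda>n. cnj (f n)) \<in> linfty" "shift f \<in> linfty" if "f \<in> linfty" for f
      using that unfolding linfty_def bounded_iff shift_def by auto
    moreover have "\<And>c f. f \<in> linfty \<Longrightarrow> (\<lambda>n. c * f n) \<in> linfty"
      using calculation(2,3) by blast
    ultimately show ?thesis by (intro anqieI) auto
  qed
  have gen: "anqie (anqie_gen f)" "f \<in> anqie_gen f" if f: "f \<in> linfty" for f
  proof -
    show "f \<in> anqie_gen f" unfolding anqie_gen_def by blast
    have "anqie_gen f \<subseteq> linfty" unfolding anqie_gen_def using linfty f by blast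
    moreover have "g \<in> anqie_gen f"
      if "g \<in> linfty" "\<forall>e>0. \<exists>h\<in>anqie_gen f. \<forall>n. norm (h n - g n) \<le> e" for g
    proof -
      have "g \<in> A" if "anqie A" "f \<in> A" for A
        by (rule anqie_limit[OF \<open>anqie A\<close> \<open>g \<in> linfty\<close>])
          (use \<open>\<forall>e>0. \<exists>h\<in>anqie_gen f. \<forall>n. norm (h n - g n) \<le> e\<close> that in \<open>unfold anqie_gen_def, blast\<close>)
      then show ?thesis unfolding anqie_gen_def by blast
    qed
    moreover have "(\<lambda>n. 1) \<in> anqie_gen f"
      unfolding anqie_gen_def by (auto intro: anqie_one)
    moreover have "(\<lambda>n. g n + h n) \<in> anqie_gen f" "(\<lambda>n. g n * h n) \<in> anqie_gen f"
      if "g \<in> anqie_gen f" "h \<in> anqie_gen f" for g h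
      using that unfolding anqie_gen_def by (auto intro: anqie_add anqie_mult)
    moreover have "(\<lambda>n. c * g n) \<in> anqie_gen f" "(\<lambda>n. cnj (g n)) \<in> anqie_gen f" "shift g \<in> anqie_gen f"
      if "g \<in> anqie_gen f" for g c
      using that unfolding anqie_gen_def by (auto intro: anqie_smult anqie_cnj anqie_shift)
    ultimately show "anqie (anqie_gen f)" by (intro anqieI)
  qed
  have "AE_seq f = 0 \<longleftrightarrow> slow {f}" if f: "f \<in> linfty" for f
  proof
    assume "AE_seq f = 0"
    then show "slow {f}" unfolding AE_seq_def by (rule slow_of_entropy_zero[OF gen(1)[OF f] _ gen(2)[OF f]])
  next
    assume s: "slow {f}"
    let ?A = "anqie_gen f"
    \<comment> \<open>Slowness of the generator spreads to the whole generated anqie, because the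
      slow bounded sequences form an anqie containing \<open>f\<close>.\<close>
    have "?A \<subseteq> {f \<in> linfty. slow {f}}"
      unfolding anqie_gen_def using anqie_slow f s by blast
    then have "cover_entropy (max_ideal_space ?A) (induced_map ?A) \<U> = 0"
      if "open_cover (max_ideal_space ?A) \<U>" for \<U>
      using slow_cover_entropy[OF gen(1)[OF f] _ that] by blast
    \<comment> \<open>The supremum of an empty family would be minus infinity; the one-member cover
      shows that the value 0 is attained.\<close>
    moreover have "open_cover (max_ideal_space ?A) {topspace (max_ideal_space ?A)}"
      unfolding open_cover_def by simp
    ultimately show "AE_seq f = 0"
      unfolding AE_seq_def anqie_entropy_def top_entropy_def
      by (intro antisym SUP_least SUP_upper2[of "{topspace (max_ideal_space ?A)}"]) auto
  qed
  then show ?thesis unfolding E0_alg_def by auto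
qed

section \<open>Finite-valued approximation\<close>

text \<open>Few aligned blocks at one suitable length \<open>L\<close> bound the windows of every
  large length: a window is determined by its offset modulo \<open>L\<close> and the labels of the
  blocks it meets.\<close>

lemma slow_of_aligned_blocks:
  assumes "\<And>d. d > 0 \<Longrightarrow> \<exists>L>0. \<exists>\<beta>::nat \<Rightarrow> nat. finite (range \<beta>) \<and>
     real (card (range \<beta>)) \<le> exp (d * real L) \<and>
     (\<forall>b b' i. \<beta> b = \<beta> b' \<longrightarrow> i < L \<longrightarrow> g (b * L + i) = g (b' * L + i))"
  shows "slow {g}"
  unfolding slow_def
proof (intro allI impI)
  fix e d :: real assume e: "e > 0" and d: "d > 0"
  obtain L and \<beta> :: "nat \<Rightarrow> nat" where L: "L > 0" and fin: "finite (range \<beta>)"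
    and card: "real (card (range \<beta>)) \<le> exp (d/2 * real L)"
    and \<beta>: "\<And>b b' i. \<beta> b = \<beta> b' \<Longrightarrow> i < L \<Longrightarrow> g (b * L + i) = g (b' * L + i)"
    using assms[OF half_gt_zero[OF d]] by blast
  have "filterlim (\<lambda>n. d/2 * real n) at_top sequentially"
    using d by (intro filterlim_tendsto_pos_mult_at_top[OF tendsto_const] filterlim_real_sequentially) auto
  then have "filterlim (\<lambda>n. exp (d/2 * real n)) at_top sequentially"
    by (rule filterlim_compose[OF exp_at_top])
  \<comment> \<open>For large \<open>n\<close> the spare half of the exponent absorbs the
    \<open>L\<close> offsets and the two extra blocks.\<close>
  then have "\<forall>\<^sub>F n in sequentially. real L * exp (d * real L) \<le> exp (d/2 * real n)"
    unfolding filterlim_at_top by (rule spec)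
  then show "\<forall>\<^sub>F n in sequentially. \<exists>N. block_code {g} e n N \<and> real N \<le> exp (d * real n)"
  proof eventually_elim
    case (elim n)
    \<comment> \<open>A window may start and end inside blocks; the largest block index used is at
      most \<open>(L + n) div L\<close>, that is \<open>n div L + 1\<close>.\<close>
    define q where "q = n div L + 2"
    define S where "S = {..<L} \<times> {xs. set xs \<subseteq> range \<beta> \<and> length xs = q}"
    define c where "c m = (m mod L, map (\<lambda>t. \<beta> (m div L + t)) [0..<q])" for m
    have "block_code {g} e n (card S)"
    proof (rule block_codeI[of S c])
      show "finite S" unfolding S_def using fin by (intro finite_cartesian_product finite_lists_length_eq) auto
      show "c m \<in> S" for m unfolding S_def c_def using L by auto
      fix m m' i f assume c: "c m = c m'" and i: "i < n" and "f \<in> {g}"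
      define t where "t = (m mod L + i) div L"
      define r where "r = (m mod L + i) mod L"
      have "m mod L + i < L + n" using i mod_less_divisor[OF L, of m] by linarith
      then have "t \<le> (L + n) div L" unfolding t_def by (intro div_le_mono) simp
      then have t: "t < q" unfolding q_def using L by simp
      have expand: "k + i = (k div L + t) * L + r" if "k mod L = m mod L" for k
      proof -
        have "k + i = k div L * L + (k mod L + i)" by simp
        also have "k mod L + i = t * L + r" unfolding t_def r_def that by simp
        finally show ?thesis by (simp add: algebra_simps)
      qed
      have "\<beta> (m div L + t) = \<beta> (m' div L + t)"
        using c t unfolding c_def by (auto simp: list_eq_iff_nth_eq)
      moreover have "r < L" unfolding r_def using L by simp
      ultimately have "g ((m div L + t) * L + r) = g ((m' div L + t) * L + r)" by (rule \<beta>)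
      moreover have "m' mod L = m mod L" using c unfolding c_def by simp
      ultimately have "g (m + i) = g (m' + i)"
        by (simp only: expand[of m, OF refl] expand[of m'])
      then show "dist (f (m + i)) (f (m' + i)) \<le> e" using e \<open>f \<in> {g}\<close> by simp
    qed simp
    moreover have "real (card S) \<le> exp (d * real n)"
    proof -
      have "n div L * L \<le> n" by simp
      then have "q * L \<le> n + 2 * L" unfolding q_def by (simp add: algebra_simps)
      then have qL: "real (q * L) \<le> real n + 2 * real L"
        by (metis (mono_tags, lifting) of_nat_add of_nat_le_iff of_nat_mult of_nat_numeral)
      have "real (card S) = real L * real (card (range \<beta>)) ^ q"
        unfolding S_def using fin by (simp add: card_cartesian_product card_lists_length_eq)
      also have "\<dots> \<le> real L * exp (d/2 * real L) ^ q"
        using card by (intro mult_left_mono power_mono) auto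
      also have "\<dots> = real L * exp (d/2 * real (q * L))"
        by (simp add: mult_ac flip: exp_of_nat_mult)
      also have "\<dots> \<le> real L * exp (d/2 * (real n + 2 * real L))"
        using qL d by (intro mult_left_mono iffD2[OF exp_le_cancel_iff]) auto
      also have "\<dots> = exp (d/2 * real n) * (real L * exp (d * real L))"
        by (simp add: distrib_left exp_add)
      also have "\<dots> \<le> exp (d/2 * real n) * exp (d/2 * real n)"
        using elim by (intro mult_left_mono) auto
      also have "\<dots> = exp (d * real n)" by (simp flip: exp_add)
      finally show ?thesis .
    qed
    ultimately show ?case by blast
  qed
qed

text \<open>The maps \<open>\<rho> k\<close> send every aligned block of length \<open>L k\<close> to the first aligned block with the
  same code; \<open>P k = \<rho> 0 \<circ> \<dots> \<circ> \<rho> (k - 1)\<close> stabilises because \<open>\<rho> k\<close> fixes the initial block.\<close>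
lemma slow_finite_valued_approx:
  assumes f: "f \<in> linfty" "slow {f}" and e: "e > 0"
  shows "\<exists>g. slow {g} \<and> finite (range g) \<and> (\<forall>n. dist (f n) (g n) \<le> e)"
proof -
  \<comment> \<open>The errors sum to at most \<open>e/2\<close>, leaving \<open>e/2\<close> for
    rounding; the rates \<delta> tend to 0 so that the final growth rate is 0.\<close>
  define \<epsilon> where "\<epsilon> k = e/4 * (1/2) ^ k" for k :: nat
  define \<delta> where "\<delta> k = 1 / real (Suc k)" for k :: nat
  have pos: "\<epsilon> k > 0" "\<delta> k > 0" for k unfolding \<epsilon>_def \<delta>_def using e by auto
  have "\<exists>n0. \<forall>n\<ge>n0. \<exists>N. block_code {f} (\<epsilon> k) n N \<and> real N \<le> exp (\<delta> k * real n)" for k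
    using slowD[OF f(2) pos(1)[of k] pos(2)[of k]] unfolding eventually_sequentially .
  then obtain n0 where n0: "\<And>k n. n \<ge> n0 k \<Longrightarrow>
      \<exists>N. block_code {f} (\<epsilon> k) n N \<and> real N \<le> exp (\<delta> k * real n)"
    by metis
  \<comment> \<open>Each length is a multiple of the previous one, at least twice as large (hence
    \<open>L k > k\<close>), and past the threshold \<open>n0 k\<close>, so that a code for windows
    of length exactly \<open>L k\<close> exists.\<close>
  define L where "L = rec_nat (n0 0 + 1) (\<lambda>k l. l * (n0 (Suc k) + 2))"
  have L0: "L 0 = n0 0 + 1" and LSuc: "L (Suc k) = L k * (n0 (Suc k) + 2)" for k
    unfolding L_def by auto
  have L_gt: "L k > k" for k
  proof (induction k)
    case (Suc k)
    have "L k * 2 \<le> L (Suc k)" unfolding LSuc by (intro mult_left_mono) auto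
    then show ?case using Suc by linarith
  qed (simp add: L0)
  have L_n0: "L k \<ge> n0 k" for k
  proof (cases k)
    case (Suc j)
    have "1 * n0 k \<le> L j * (n0 k + 2)" using L_gt[of j] by (intro mult_mono) auto
    then show ?thesis using Suc LSuc[of j] by simp
  qed (simp add: L0)
  have L_pos: "L k > 0" for k using L_gt[of k] by simp
  have L_dvd: "L j dvd L k" if "j \<le> k" for j k
    using that by (induction k rule: dec_induct) (auto simp: LSuc)
  have "\<exists>N c. (\<forall>m. c m < N) \<and> real N \<le> exp (\<delta> k * real (L k)) \<and>
      (\<forall>m m' i. c m = c m' \<longrightarrow> i < L k \<longrightarrow> dist (f (m + i)) (f (m' + i)) \<le> \<epsilon> k)" for k
    using n0[OF L_n0[of k]] unfolding block_code_def by (metis singletonI)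
  then obtain N c where c: "\<And>k m. c k m < N k" "\<And>k. real (N k) \<le> exp (\<delta> k * real (L k))"
    "\<And>k m m' i. c k m = c k m' \<Longrightarrow> i < L k \<Longrightarrow> dist (f (m + i)) (f (m' + i)) \<le> \<epsilon> k"
    by metis
  \<comment> \<open>Taking the first block with the given code, rather than an arbitrary one, makes
    \<open>r k\<close> fix block 0.\<close>
  define r where "r k b = (LEAST b'. c k (b' * L k) = c k (b * L k))" for k b
  have r: "c k (r k b * L k) = c k (b * L k)" for k b
    unfolding r_def by (rule LeastI[of _ b]) simp
  have r0: "r k 0 = 0" for k unfolding r_def by simp
  have range_r: "finite (range (r k))" "card (range (r k)) \<le> N k" for k
  proof -
    have "range (r k) \<subseteq> (\<lambda>j. LEAST b'. c k (b' * L k) = j) ` {..<N k}"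
      unfolding r_def using c(1) by auto
    then show "finite (range (r k))" "card (range (r k)) \<le> N k"
      using surj_card_le[of "{..<N k}" "range (r k)"] finite_surj[of "{..<N k}"] by auto
  qed
  define \<rho> where "\<rho> k n = r k (n div L k) * L k + n mod L k" for k n
  have dist_\<rho>: "dist (f (\<rho> k n)) (f n) \<le> \<epsilon> k" for k n
    using c(3)[OF r[of k "n div L k"], of "n mod L k"] L_pos[of k] unfolding \<rho>_def by simp
  have \<rho>_init: "\<rho> k n = n" if "n < L k" for k n
    unfolding \<rho>_def using that by (simp add: r0)
  \<comment> \<open>New maps enter on the inside, so the longest blocks are moved first.\<close>
  define P where "P = rec_nat id (\<lambda>k p. p \<circ> \<rho> k)"
  have P0: "P 0 n = n" and PSuc: "P (Suc k) n = P k (\<rho> k n)" for k n unfolding P_def by auto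
  have dist_P: "dist (f (P k n)) (f n) \<le> (\<Sum>j<k. \<epsilon> j)" for k n
  proof (induction k arbitrary: n)
    case (Suc k)
    have "dist (f (P (Suc k) n)) (f n) \<le> dist (f (P k (\<rho> k n))) (f (\<rho> k n)) + dist (f (\<rho> k n)) (f n)"
      unfolding PSuc by (rule dist_triangle)
    then show ?case using Suc[of "\<rho> k n"] dist_\<rho>[of k n] by simp
  qed (simp add: P0)
  have sum_\<epsilon>: "(\<Sum>j<k. \<epsilon> j) \<le> e/2" for k
  proof -
    have "(\<Sum>j<k. \<epsilon> j) = e/2 * (1 - (1/2) ^ k)"
      by (induction k) (auto simp: \<epsilon>_def algebra_simps)
    also have "\<dots> \<le> e/2 * 1" using e by (intro mult_left_mono) auto
    finally show ?thesis by simp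
  qed
  have P_stable: "P k n = P n n" if "n \<le> k" for k n
    using that
  proof (induction k rule: dec_induct)
    case (step k)
    then show ?case using \<rho>_init[of n k] L_gt[of k] by (simp add: PSuc)
  qed simp
  \<comment> \<open>Once \<rho> at level \<open>k\<close> has acted, only blocks from the range of
    \<open>r k\<close> remain. The maps of higher level act earlier and carry aligned blocks of
    length \<open>L k\<close> rigidly to such blocks, since \<open>L k\<close> divides
    \<open>L K\<close>.\<close>
  have P_block: "\<exists>b'. \<forall>i<L k. P K (b * L k + i) = P k (r k b' * L k + i)" if "Suc k \<le> K" for k K b
    using that
  proof (induction K arbitrary: b rule: dec_induct)
    case base
    show ?case using L_pos[of k] by (auto simp: PSuc \<rho>_def intro!: exI[of _ b])
  next
    case (step K)
    obtain s where s: "L K = L k * s" using L_dvd[of k K] step(1) by (auto simp: dvd_def)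
    then have "s > 0" using L_pos[of K] by (cases s) auto
    have "\<exists>b'. \<forall>i<L k. \<rho> K (b * L k + i) = b' * L k + i"
    \<comment> \<open>With \<open>L K = L k * s\<close>, block \<open>b\<close> sits at place
      \<open>b mod s\<close> inside the large block \<open>b div s\<close>; the large block moves
      and the place is kept.\<close>
    proof (intro exI[of _ "r K (b div s) * s + b mod s"] allI impI)
      fix i assume i: "i < L k"
      have "(b * L k + i) div L K = b div s" "(b * L k + i) mod L K = (b mod s) * L k + i"
        using i L_pos[of k] unfolding s div_mult2_eq mod_mult2_eq by auto
      then show "\<rho> K (b * L k + i) = (r K (b div s) * s + b mod s) * L k + i"
        unfolding \<rho>_def by (simp add: s algebra_simps)
    qed
    then obtain b' where b': "\<And>i. i < L k \<Longrightarrow> \<rho> K (b * L k + i) = b' * L k + i" by blast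
    obtain b'' where "\<And>i. i < L k \<Longrightarrow> P K (b' * L k + i) = P k (r k b'' * L k + i)"
      using step.IH[of b'] by blast
    then show ?case using b' by (auto simp: PSuc intro!: exI[of _ b''])
  qed
  define p where "p n = P n n" for n
  have "\<exists>s. s \<in> range (r k) \<and> (\<forall>i<L k. p (b * L k + i) = P k (s * L k + i))" for k b
  proof -
    \<comment> \<open>Large enough to exceed \<open>k\<close> and every position of block
      \<open>b\<close>, where \<open>P\<close> has then stabilised.\<close>
    define K where "K = Suc k + Suc b * L k"
    have "p (b * L k + i) = P K (b * L k + i)" if "i < L k" for i
      unfolding p_def using P_stable[of "b * L k + i" K] that unfolding K_def by simp
    then show ?thesis using P_block[of k K b] unfolding K_def by auto
  qed
  then obtain \<beta> where \<beta>: "\<And>k b. \<beta> k b \<in> range (r k)"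
    "\<And>k b i. i < L k \<Longrightarrow> p (b * L k + i) = P k (\<beta> k b * L k + i)"
    by metis
  \<comment> \<open>The rounding \<open>q\<close> depends on the position and not on the value of
    \<open>f\<close>. Composed with \<open>p\<close> it creates no new blocks, as equal labels give
    equal positions under \<open>p\<close>.\<close>
  have "\<exists>q. finite (range q) \<and> (\<forall>n. dist (f n) (q n) \<le> e/2)"
  proof -
    obtain B where B: "\<And>n. norm (f n) \<le> B" using linfty_bound[OF f(1)] by blast
    obtain Z :: "complex set" where Z: "finite Z" "cball 0 B \<subseteq> (\<Union>z\<in>Z. ball z (e/2))"
      using finite_ball_cover[OF compact_cball half_gt_zero[OF e]] by blast
    have "\<exists>z. z \<in> Z \<and> dist (f n) z \<le> e/2" for n
      using Z(2) B[of n] by (force simp: dist_commute subset_iff)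
    then obtain q where "\<And>n. q n \<in> Z \<and> dist (f n) (q n) \<le> e/2" by metis
    then show ?thesis using Z(1) by (intro exI[of _ q]) (auto intro: finite_subset)
  qed
  then obtain q where q: "finite (range q)" "\<And>n. dist (f n) (q n) \<le> e/2" by blast
  have "slow {\<lambda>n. q (p n)}"
  proof (rule slow_of_aligned_blocks)
    fix d :: real assume "d > 0"
    then obtain k where k: "1 / real (Suc k) < d" using nat_approx_posE by blast
    have "range (\<beta> k) \<subseteq> range (r k)" using \<beta>(1) by blast
    then have "finite (range (\<beta> k))" "card (range (\<beta> k)) \<le> N k"
      using range_r[of k] by (auto intro: finite_subset card_mono order_trans)
    moreover have "real (N k) \<le> exp (d * real (L k))"
    proof -
      have "\<delta> k * real (L k) \<le> d * real (L k)" unfolding \<delta>_def using k by (intro mult_right_mono) auto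
      then show ?thesis using c(2)[of k] by (meson exp_le_cancel_iff order_trans)
    qed
    ultimately show "\<exists>L>0. \<exists>\<beta>::nat \<Rightarrow> nat. finite (range \<beta>) \<and>
       real (card (range \<beta>)) \<le> exp (d * real L) \<and>
       (\<forall>b b' i. \<beta> b = \<beta> b' \<longrightarrow> i < L \<longrightarrow> q (p (b * L + i)) = q (p (b' * L + i)))"
      using L_pos[of k] \<beta>(2)[of _ k] by (intro exI[of _ "L k"] conjI exI[of _ "\<beta> k"]) auto
  qed
  moreover have "finite (range (\<lambda>n. q (p n)))"
    by (rule finite_subset[OF _ q(1)]) auto
  moreover have "dist (f n) (q (p n)) \<le> e" for n
    using dist_triangle[of "f n" "q (p n)" "f (p n)"] q(2)[of "p n"] dist_P[of n n] sum_\<epsilon>[of n]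
    unfolding p_def by (simp add: dist_commute)
  ultimately show ?thesis by blast
qed

section \<open>The arithmetic compactification\<close>

lemma anqie_E0: "anqie E0_alg"
  unfolding E0_alg_eq by (rule anqie_slow)

text \<open>On characters the value at a finite-valued \<open>g\<close> stays in the range of
  \<open>g\<close>, so prescribing that value is both an open and a closed condition.\<close>

lemma totally_disconnected_arith: "totally_disconnected_space arith_compactification"
  unfolding totally_disconnected_space_def
proof (intro ballI impI)
  let ?X = arith_compactification
  fix x y assume "x \<in> topspace ?X" "y \<in> topspace ?X" and "x \<noteq> y"
  then have x: "character E0_alg x" and y: "character E0_alg y"
    unfolding arith_compactification_def topspace_max_ideal_space by auto
  obtain f where neq: "x f \<noteq> y f" using \<open>x \<noteq> y\<close> by blast
  then have f: "f \<in> E0_alg" using character_outside[OF x] character_outside[OF y] by metis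
  \<comment> \<open>Two errors of size \<open>e\<close> stay below the distance
    \<open>3 * e\<close>, so \<open>g\<close> still separates \<open>x\<close> from
    \<open>y\<close>.\<close>
  define e where "e = dist (x f) (y f) / 3"
  have e: "e > 0" using neq unfolding e_def by simp
  obtain g where g: "slow {g}" "finite (range g)" "\<And>n. dist (f n) (g n) \<le> e"
    using slow_finite_valued_approx[of f e] f e unfolding E0_alg_eq by blast
  have gE: "g \<in> E0_alg"
    unfolding E0_alg_eq linfty_def using g finite_imp_bounded by blast
  have close: "dist (z f) (z g) \<le> e" if z: "character E0_alg z" for z
    using character_norm_le[OF anqie_E0 z anqie_diff[OF anqie_E0 f gE], of e]
      character_diff[OF anqie_E0 z f gE] g(3) by (simp add: dist_norm)
  have "x g \<noteq> y g"
  proof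
    assume "x g = y g"
    then have "dist (x f) (y f) \<le> e + e"
      using close[OF x] close[OF y] dist_triangle2[of "x f" "y f" "x g"] by simp
    then show False using e unfolding e_def by simp
  qed
  \<comment> \<open>By density of evaluations the value is a limit of values of \<open>g\<close>,
    and a finite range is closed.\<close>
  have in_range: "z g \<in> range g" if z: "character E0_alg z" for z
  proof -
    have "z g \<in> closure (range g)"
      unfolding closure_approachable
    proof (intro allI impI)
      fix d :: real assume "d > 0"
      then obtain m where "dist (z g) (g m) < d"
        using character_approx[OF anqie_E0 z, of "{g}" d] gE by auto
      then show "\<exists>w\<in>range g. dist w (z g) < d" by (auto simp: dist_commute)
    qed
    then show ?thesis using g(2) by (simp add: finite_imp_closed)
  qed
  define C where "C = {z. character E0_alg z \<and> z g = x g}"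
  have C_closed: "C = {z. character E0_alg z} \<inter> (\<lambda>z. z g) -` {x g}" unfolding C_def by auto
  have C_open: "C = (\<lambda>z. z g) -` (- (range g - {x g})) \<inter> {z. character E0_alg z}"
    unfolding C_def using in_range by auto
  have "closedin ?X C"
    unfolding arith_compactification_def max_ideal_space_def C_closed
    by (intro closedin_closed_Int closed_vimage continuous_on_product_coordinates) auto
  moreover have "openin ?X C"
  proof -
    have "open ((\<lambda>z::seq\<Rightarrow>complex. z g) -` (- (range g - {x g})))"
      using g(2) by (intro open_vimage continuous_on_product_coordinates open_Compl finite_imp_closed) auto
    then show ?thesis
      unfolding arith_compactification_def max_ideal_space_def openin_subtopology C_open
      by (auto simp flip: open_openin)
  qed
  moreover have "x \<in> C" "y \<notin> C" using x \<open>x g \<noteq> y g\<close> unfolding C_def by auto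
  ultimately show "\<exists>C. closedin ?X C \<and> openin ?X C \<and> x \<in> C \<and> y \<notin> C" by blast
qed

text \<open>A clopen set and its complement form an open cover. Its Lebesgue number forces
  evaluations that agree closely on a finite set of slow functions to lie on the same side.\<close>

lemma slow_indicator_of_clopen:
  assumes A: "anqie A" and slow: "\<And>f. f \<in> A \<Longrightarrow> slow {f}"
    and C: "openin (max_ideal_space A) C" "closedin (max_ideal_space A) C"
  shows "slow {\<lambda>m. if point_eval A m \<in> C then 1 else 0}"
proof (rule slow_transfer)
  fix e :: real assume e: "e > 0"
  let ?X = "max_ideal_space A"
  define \<U> where "\<U> = {C, topspace ?X - C}"
  have cover: "open_cover ?X \<U>"
    unfolding open_cover_def \<U>_def using C openin_subset[OF C(1)] by auto
  obtain F d where F: "finite F" "F \<subseteq> A" "d > 0" and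
    Leb: "\<And>y. character A y \<Longrightarrow> \<exists>U\<in>\<U>.
       \<forall>z. character A z \<longrightarrow> (\<forall>f\<in>F. dist (z f) (y f) < d) \<longrightarrow> z \<in> U"
    using character_Lebesgue_number[OF A cover] by blast
  \<comment> \<open>Halving \<open>d\<close> turns the weak inequality required by
    \<open>slow_transfer\<close> into the strict one of the Lebesgue number.\<close>
  have "point_eval A m \<in> C \<longleftrightarrow> point_eval A m' \<in> C"
    if mm': "\<forall>f\<in>F. dist (f m) (f m') \<le> d/2" for m m'
  proof -
    obtain U where U: "U \<in> \<U>"
      "\<And>z. character A z \<Longrightarrow> (\<forall>f\<in>F. dist (z f) (point_eval A m f) < d) \<Longrightarrow> z \<in> U"
      using Leb[OF character_point_eval[OF A]] by blast
    have "dist (point_eval A m' f) (point_eval A m f) < d" if "f \<in> F" for f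
      using mm' that F unfolding point_eval_def by (force simp: dist_commute)
    then have "point_eval A m' \<in> U"
      by (intro U(2) character_point_eval[OF A]) auto
    moreover have "point_eval A m \<in> U"
      using F(3) by (intro U(2) character_point_eval[OF A]) auto
    ultimately show ?thesis using U(1) unfolding \<U>_def by auto
  qed
  moreover have "slow F" using slow_finite[OF F(1)] slow F(2) by blast
  ultimately show "\<exists>F d. d > 0 \<and> slow F \<and> (\<forall>m m'. (\<forall>f\<in>F. dist (f m) (f m') \<le> d) \<longrightarrow>
      dist (if point_eval A m \<in> C then 1 else 0) (if point_eval A m' \<in> C then 1 else 0 :: complex) \<le> e)"
    using F(3) e by (intro exI[of _ F] exI[of _ "d/2"]) auto
qed

text \<open>With \<open>L\<close> beyond the support there are just two kinds of aligned blocks, the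
  initial one and the zero block; \<open>L\<close> is also taken so large that
  \<open>2 \<le> exp (d * L)\<close>.\<close>

lemma slow_finite_support:
  assumes "finite {n. f n \<noteq> 0}"
  shows "slow {f}"
proof (rule slow_of_aligned_blocks)
  fix d :: real assume d: "d > 0"
  obtain M where M: "\<And>n. n \<ge> M \<Longrightarrow> f n = 0"
    using assms unfolding finite_nat_set_iff_bounded by (metis (mono_tags, lifting) leD mem_Collect_eq)
  obtain k :: nat where k: "ln 2 / d < real k" using reals_Archimedean2 by blast
  define L where "L = M + k + 1"
  define \<beta> where "\<beta> b = (if b = 0 then 0 else 1::nat)" for b :: nat
  have sub: "range \<beta> \<subseteq> {0, 1}" unfolding \<beta>_def by auto
  then have "finite (range \<beta>)" using finite_subset by blast
  have "card (range \<beta>) \<le> 2" using card_mono[OF _ sub] by simp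
  moreover have exp_ge: "2 \<le> exp (d * real L)"
  proof -
    have "ln 2 \<le> d * real k" using k d by (simp add: field_simps)
    also have "\<dots> \<le> d * real L" using d unfolding L_def by (intro mult_left_mono) auto
    finally have "ln 2 \<le> d * real L" .
    then show ?thesis by (metis exp_le_cancel_iff exp_ln zero_less_numeral)
  qed
  moreover have "f (b * L + i) = f (b' * L + i)" if "\<beta> b = \<beta> b'" for b b' i
  proof (cases "b = 0")
    case True then show ?thesis using that unfolding \<beta>_def by (auto split: if_splits)
  next
    case False
    then have "b' > 0" "b > 0" using that unfolding \<beta>_def by (auto split: if_splits)
    then have "1 * L \<le> b * L" "1 * L \<le> b' * L" by (intro mult_right_mono; simp)+
    then show ?thesis using M unfolding L_def by simp
  qed
  moreover have "L > 0" unfolding L_def by simp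
  moreover have "real (card (range \<beta>)) \<le> exp (d * real L)"
    using \<open>card (range \<beta>) \<le> 2\<close> exp_ge by linarith
  ultimately show "\<exists>L>0. \<exists>\<beta>::nat \<Rightarrow> nat. finite (range \<beta>) \<and>
     real (card (range \<beta>)) \<le> exp (d * real L) \<and>
     (\<forall>b b' i. \<beta> b = \<beta> b' \<longrightarrow> i < L \<longrightarrow> f (b * L + i) = f (b' * L + i))"
    using \<open>finite (range \<beta>)\<close> by blast
qed

section \<open>The natural numbers as isolated points\<close>

lemma point_mass_E0: "(\<lambda>n. if n = m then 1 else 0) \<in> E0_alg"
proof -
  have "slow {\<lambda>n. if n = m then 1 else 0}" by (rule slow_finite_support) simp
  moreover have "(\<lambda>n. if n = m then 1 else 0) \<in> linfty" by (rule linftyI[of _ 1]) simp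
  ultimately show ?thesis unfolding E0_alg_eq by simp
qed

lemma inj_point_eval_E0: "inj (point_eval E0_alg)"
proof (rule injI)
  fix m k assume "point_eval E0_alg m = point_eval E0_alg k"
  then have "point_eval E0_alg m (\<lambda>n. if n = m then 1 else 0) =
      point_eval E0_alg k (\<lambda>n. if n = m then 1 else 0)" by simp
  then show "m = k" by (simp add: point_eval_def point_mass_E0 split: if_splits)
qed

text \<open>Since \<open>f * \<delta> = f m * \<delta>\<close> for the point mass \<delta> at
  \<open>m\<close>, a character not vanishing at \<delta> must be evaluation at \<open>m\<close>;
  nonvanishing is an open condition.\<close>

lemma openin_point_eval: "openin arith_compactification {point_eval E0_alg m}"
proof -
  define \<delta> :: seq where "\<delta> n = (if n = m then 1 else 0)" for n
  have \<delta>: "\<delta> \<in> E0_alg" unfolding \<delta>_def[abs_def] by (rule point_mass_E0)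
  have "z = point_eval E0_alg m" if z: "character E0_alg z" "z \<delta> \<noteq> 0" for z
  proof
    fix f
    show "z f = point_eval E0_alg m f"
    proof (cases "f \<in> E0_alg")
      case True
      have "(\<lambda>n. f n * \<delta> n) = (\<lambda>n. f m * \<delta> n)" by (auto simp: \<delta>_def)
      then have "z f * z \<delta> = f m * z \<delta>"
        using character_mult[OF z(1) True \<delta>] character_smult[OF z(1) \<delta>] by metis
      then show ?thesis using z(2) True by (simp add: point_eval_def)
    qed (use character_outside[OF z(1)] in \<open>simp add: point_eval_def\<close>)
  qed
  moreover have "point_eval E0_alg m \<delta> = 1" using \<delta> by (simp add: point_eval_def \<delta>_def)
  ultimately have "{point_eval E0_alg m} = (\<lambda>z. z \<delta>) -` (- {0}) \<inter> {z. character E0_alg z}"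
    using character_point_eval[OF anqie_E0] by auto
  moreover have "open ((\<lambda>z::seq\<Rightarrow>complex. z \<delta>) -` (- {0}))"
    by (intro open_vimage continuous_on_product_coordinates) auto
  ultimately show ?thesis
    unfolding arith_compactification_def max_ideal_space_def openin_subtopology
    by (auto simp flip: open_openin)
qed

text \<open>On the block of length \<open>2^j\<close> starting at \<open>2^j\<close> stand the binary digits of \<open>j\<close>, so every
  0-1 word occurs.\<close>
definition digit_set :: "nat set" where
  "digit_set = {2 ^ j + i | j i. i < 2 ^ j \<and> bit j i}"

text \<open>The intervals from \<open>2 ^ j\<close> to \<open>2 ^ Suc j\<close> are disjoint, so a
  position determines its block.\<close>

lemma mem_digit_set:
  assumes "i < 2 ^ j"
  shows "2 ^ j + i \<in> digit_set \<longleftrightarrow> bit j i"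
proof
  assume "2 ^ j + i \<in> digit_set"
  then obtain j' i' where j': "2 ^ j + i = 2 ^ j' + i'" "i' < 2 ^ j'" "bit j' i'"
    unfolding digit_set_def by blast
  have "j = j'"
  proof (rule antisym; rule ccontr)
    assume "\<not> j \<le> j'"
    then have "(2::nat) ^ Suc j' \<le> 2 ^ j" by (intro power_increasing) auto
    then show False using j' by simp
  next
    assume "\<not> j' \<le> j"
    then have "(2::nat) ^ Suc j \<le> 2 ^ j'" by (intro power_increasing) auto
    then show False using j' assms by simp
  qed
  then show "bit j i" using j' by simp
qed (use assms in \<open>auto simp: digit_set_def\<close>)

text \<open>All \<open>2 ^ n\<close> binary words of length \<open>n\<close> occur, and tolerance
  1/2 tells 0 from 1, so \<open>2 ^ n\<close> labels are needed; this exceeds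
  \<open>exp (n/2)\<close>.\<close>

lemma not_slow_digit_set: "\<not> slow {\<lambda>n. if n \<in> digit_set then 1 else 0}" (is "\<not> slow {?g}")
proof
  assume "slow {?g}"
  then have "\<forall>\<^sub>F n in sequentially. \<exists>N. block_code {?g} (1/2) n N \<and> real N \<le> exp (1/2 * real n)"
    by (intro slowD) auto
  then obtain n0 where n0: "\<And>n. n \<ge> n0 \<Longrightarrow> \<exists>N. block_code {?g} (1/2) n N \<and> real N \<le> exp (1/2 * real n)"
    unfolding eventually_sequentially by blast
  define n where "n = Suc n0"
  obtain N where N: "block_code {?g} (1/2) n N" "real N \<le> exp (1/2 * real n)"
    using n0[of n] unfolding n_def by auto
  obtain c where c: "\<And>m. c m < N"
    "\<And>m m' i. \<lbrakk>c m = c m'; i < n\<rbrakk> \<Longrightarrow> dist (?g (m + i)) (?g (m' + i)) \<le> 1/2"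
    using N(1) unfolding block_code_def by blast
  \<comment> \<open>Adding \<open>2 ^ n\<close> to \<open>j\<close> leaves its \<open>n\<close>
    lowest digits unchanged and makes the block longer than \<open>n\<close>.\<close>
  define w where "w j = (2::nat) ^ (2 ^ n + j)" for j
  have digits: "w j + i \<in> digit_set \<longleftrightarrow> bit j i" if "i < n" "j < 2 ^ n" for i j
  proof -
    have "n < 2 ^ n" by (rule less_exp)
    also have "(2::nat) ^ n \<le> 2 ^ (2 ^ n + j)"
      by (intro power_increasing trans_le_add1 less_imp_le[OF less_exp]) auto
    finally have "i < 2 ^ (2 ^ n + j)" using that by simp
    then have "w j + i \<in> digit_set \<longleftrightarrow> bit (2 ^ n + j) i"
      unfolding w_def by (rule mem_digit_set)
    also have "\<dots> \<longleftrightarrow> bit (take_bit n (2 ^ n + j)) i" using that by (simp add: bit_take_bit_iff)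
    also have "take_bit n (2 ^ n + j) = j" using that by (simp add: take_bit_eq_mod)
    finally show ?thesis .
  qed
  have "inj_on (\<lambda>j. c (w j)) {..<2 ^ n}"
  proof (rule inj_onI)
    fix j k :: nat assume j: "j \<in> {..<2 ^ n}" and k: "k \<in> {..<2 ^ n}" and eq: "c (w j) = c (w k)"
    have "bit j i \<longleftrightarrow> bit k i" for i
    proof (cases "i < n")
      case True
      have "w j + i \<in> digit_set \<longleftrightarrow> w k + i \<in> digit_set"
        using c(2)[OF eq True] by (auto split: if_splits)
      then show ?thesis using digits[OF True] j k by simp
    next
      case False
      have "take_bit n j = j" "take_bit n k = k" using j k by (auto simp: take_bit_eq_mod)
      then show ?thesis using False by (metis bit_take_bit_iff)
    qed
    then show "j = k" by (simp add: bit_eq_iff)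
  qed
  moreover have "(\<lambda>j. c (w j)) ` {..<2 ^ n} \<subseteq> {..<N}" using c(1) by auto
  ultimately have "card {..<(2::nat) ^ n} \<le> card {..<N}" by (intro card_inj_on_le) auto
  then have "2 ^ n \<le> N" by simp
  then have "real (2 ^ n) \<le> real N" by (rule of_nat_mono)
  also have "\<dots> \<le> exp (1/2 * real n)" by (rule N(2))
  also have "\<dots> = exp (1/2) ^ n" by (simp only: mult.commute[of "1/2"] exp_of_nat_mult)
  finally have "(2::real) ^ n \<le> exp (1/2) ^ n" by simp
  moreover have "exp (1/2::real) < 2"
  proof -
    have "exp (1/2::real) ^ 2 = exp 1" by (simp flip: exp_of_nat_mult)
    also have "\<dots> < 2 ^ 2" using e_less_272 by simp
    finally show ?thesis by (rule power_less_imp_less_base) simp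
  qed
  then have "exp (1/2::real) ^ n < 2 ^ n" unfolding n_def by (intro power_strict_mono) auto
  ultimately show False by linarith
qed

theorem theorem1p5:
  shows "totally_disconnected_space arith_compactification \<and>
         \<not> extremely_disconnected_space arith_compactification"
proof
  show "totally_disconnected_space arith_compactification" by (rule totally_disconnected_arith)
  show "\<not> extremely_disconnected_space arith_compactification"
  proof
    assume ext: "extremely_disconnected_space arith_compactification"
    let ?X = arith_compactification
    define U where "U = (\<Union>m\<in>digit_set. {point_eval E0_alg m})"
    have U: "openin ?X U" unfolding U_def by (intro openin_Union) (auto intro: openin_point_eval)
    define C where "C = ?X closure_of U"
    have C: "openin ?X C" "closedin ?X C"
      using ext U unfolding C_def extremely_disconnected_space_def by auto
    have "point_eval E0_alg m \<in> C \<longleftrightarrow> m \<in> digit_set" for m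
    proof
      assume "point_eval E0_alg m \<in> C"
      \<comment> \<open>An isolated point of the closure has itself as a neighbourhood meeting
        \<open>U\<close>.\<close>
      then have "point_eval E0_alg m \<in> U"
        using openin_point_eval[of m] unfolding C_def in_closure_of by blast
      then show "m \<in> digit_set" using inj_point_eval_E0 unfolding U_def by (auto dest: injD)
    next
      assume "m \<in> digit_set"
      then show "point_eval E0_alg m \<in> C"
        using closure_of_subset[OF openin_subset[OF U]] unfolding C_def U_def by auto
    qed
    then have "slow {\<lambda>m. if m \<in> digit_set then 1 else 0}"
      using slow_indicator_of_clopen[OF anqie_E0 _ C[unfolded arith_compactification_def]]
      by (simp add: E0_alg_eq)
    then show False using not_slow_digit_set by blast
  qed
qed

end
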